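(* Assume that for every $g\in\mathcal G$ there exists $h_g\in\mathcal H$ such that $\langle h_g-f_g,h\rangle_{L^2(\mathbb P_X)}=0$ for all $h\in\mathcal H$. Then the linear operator ${}^{u}C_X^{\dagger}\,{}^{u}C_{XY}\colon\mathcal G\to\mathcal H$ is bounded and, for all $y\in\mathcal Y$ and $h\in\mathcal H$, $$\langle h,\mu_{Y|X=\cdot}(y)\rangle_{L^2(\mathbb P_X)}=\Big\langle h,\big(({}^{u}C_X^{\dagger}\,{}^{u}C_{XY})^{*}\varphi(\cdot)\big)(y)\Big\rangle_{L^2(\mathbb P_X)}.$$ Suppose in addition that any one of the following four conditions holds: (i) the kernel $k$ is $L^2$-universal; (ii) $\mathcal H$ is dense in $L^2(\mathbb P_X)$; (iii) $f_g\in\mathcal H$ for all $g\in\mathcal G$; (iv) $f_{\psi(y)}\in\mathcal H$ for each $y\in\mathcal Y$. Then, for $\mathbb P_X$-a.e. $x\in\mathcal X$, $$\mu_{Y|X=x}=({}^{u}C_X^{\dagger}\,{}^{u}C_{XY})^{*}\varphi(x).$$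
   Context: Setting. $(\Omega,\Sigma,\mathbb P)$ is a probability space, $\mathcal X$ a measurable space, $\mathcal Y$ a Borel space (Borel isomorphic to a Borel subset of $[0,1]$). $k\colon\mathcal X\times\mathcal X\to\mathbb R$ and $\ell\colon\mathcal Y\times\mathcal Y\to\mathbb R$ are symmetric positive definite kernels such that $k(x,\cdot)$ and $\ell(y,\cdot)$ are Borel measurable for all $x,y$. $\mathcal H$ and $\mathcal G$ are the RKHSs of $k$ and $\ell$, assumed separable, with canonical feature maps $\varphi(x)=k(x,\cdot)\in\mathcal H$, $\psi(y)=\ell(y,\cdot)\in\mathcal G$. $X\colon\Omega\to\mathcal X$ and $Y\colon\Omega\to\mathcal Y$ are random variables with laws $\mathbb P_X,\mathbb P_Y$; $\mathbb P_{Y|X=x}$ is a fixed regular conditional distribution of $Y$ given $X=x$ (it exists and is $\mathbb P_X$-a.e. unique). Assume $\mathbb E[\|\varphi(X)\|_{\mathcal H}^2+\|\psi(Y)\|_{\mathcal G}^2]<\infty$. Then $\mathcal X_Y=\{x\in\mathcal X:\mathbb E[\|\psi(Y)\|_{\mathcal G}^2|X=x]<\infty\}$ has full $\mathbb P_X$-measure. Assume also that for $h\in\mathcal H$, $h=0$ $\mathbb P_X$-a.e. if and only if $h=0$; thus $\mathcal H$ is viewed as a subspace of $L^2(\mathbb P_X)$, and for $f\in L^2(\mathbb P_X)$ we write $f\in\mathcal H$ if $f$ agrees $\mathbb P_X$-a.e. with a (unique) element of $\mathcal H$. Uncentred covariances. Expectations of Hilbert-space-valued variables are Bochner integrals. For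 square-integrable $U,V$ with values in Hilbert spaces $\mathcal G,\mathcal H$, ${}^{u}\operatorname{Cov}[U,V]=\mathbb E[U\otimes V]\colon\mathcal H\to\mathcal G$, where $(g\otimes h)(h')=\langle h,h'\rangle g$. Set ${}^{u}C_X={}^{u}\operatorname{Cov}[\varphi(X),\varphi(X)]$ and ${}^{u}C_{XY}={}^{u}\operatorname{Cov}[\varphi(X),\psi(Y)]\colon\mathcal G\to\mathcal H$. Conditional objects. $\mu_{Y|X=x}=\mathbb E[\psi(Y)|X=x]\in\mathcal G$ (integral of $\psi$ against $\mathbb P_{Y|X=x}$) for $x\in\mathcal X_Y$ and $\mu_{Y|X=x}=0$ otherwise. For $g\in\mathcal G$, $f_g(x)=\mathbb E[g(Y)|X=x]$ for $x\in\mathcal X_Y$ and $f_g(x)=0$ otherwise; $f_g\in L^2(\mathbb P_X)$. The kernel $k$ is $L^2$-universal if it is Borel measurable and bounded and $\mathcal H$ is dense in $L^2(\mathbb Q)$ for every probability measure $\mathbb Q$ on $\mathcal X$. $A^{*}$ is the adjoint and $A^{\dagger}$ the Moore–Penrose pseudo-inverse of a bounded operator $A$ between Hilbert spaces: the linear extension of $(A|_{(\ker A)^\perp})^{-1}\colon\operatorname{ran}A\to(\ker A)^\perp$ to $\operatorname{dom}A^\dagger=\operatorname{ran}A\oplus(\operatorname{ran}A)^\perp$ with $\ker A^\dagger=(\operatorname{ran}A)^\perp$ (possibly unbounded); ${}^{u}C_X^{\dagger}$ means $({}^{u}C_X)^{\dagger}$. *)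

theory Defs
  imports "HOL-Probability.Probability"
begin

definition sym_pos_def_kernel :: "'x set \<Rightarrow> ('x \<Rightarrow> 'x \<Rightarrow> real) \<Rightarrow> bool" where
  "sym_pos_def_kernel S k \<longleftrightarrow>
     (\<forall>x\<in>S. \<forall>x'\<in>S. k x x' = k x' x) \<and>
     (\<forall>F c. finite F \<and> F \<subseteq> S \<longrightarrow> 0 \<le> (\<Sum>x\<in>F. \<Sum>x'\<in>F. c x * c x' * k x x'))"

text \<open>
  A type \<open>'h\<close> is the RKHS of \<open>k\<close> on \<open>S\<close> with canonical feature map \<open>\<phi>\<close>: \<open>val\<close> identifies
  elements of \<open>'h\<close> with functions on \<open>S\<close> (values of \<open>val h\<close> and \<open>\<phi>\<close> outside \<open>S\<close> are
  irrelevant), and \<open>\<phi> x\<close> is the element whose function is \<open>k x\<close>. Completeness is to be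
  supplied by the sort \<open>banach\<close>, separability by the sort \<open>second_countable_topology\<close>.
\<close>
definition is_rkhs ::
  "'x set \<Rightarrow> ('x \<Rightarrow> 'x \<Rightarrow> real) \<Rightarrow> ('h::{real_inner, banach} \<Rightarrow> 'x \<Rightarrow> real) \<Rightarrow> ('x \<Rightarrow> 'h) \<Rightarrow> bool" where
  "is_rkhs S k val \<phi> \<longleftrightarrow>
     (\<forall>x\<in>S. linear (\<lambda>h. val h x)) \<and>
     (\<forall>h h'. (\<forall>x\<in>S. val h x = val h' x) \<longrightarrow> h = h') \<and>
     (\<forall>x\<in>S. \<forall>x'\<in>S. val (\<phi> x) x' = k x x') \<and>
     (\<forall>h. \<forall>x\<in>S. val h x = h \<bullet> \<phi> x)"

definition borel_space :: "'y measure \<Rightarrow> bool" where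
  "borel_space N \<longleftrightarrow>
     (\<exists>B f g. B \<in> sets (borel :: real measure) \<and> B \<subseteq> {0..1} \<and>
        f \<in> N \<rightarrow>\<^sub>M restrict_space borel B \<and> g \<in> restrict_space borel B \<rightarrow>\<^sub>M N \<and>
        (\<forall>y\<in>space N. g (f y) = y) \<and> (\<forall>b\<in>B. f (g b) = b))"

text \<open>\<open>\<kappa> x\<close> plays the role of the law of \<open>Y\<close> given \<open>X = x\<close>; measurability into
  \<open>prob_algebra\<close> says that \<open>\<kappa>\<close> is a Markov kernel.\<close>
definition regular_cond_dist ::
  "'w measure \<Rightarrow> 'x measure \<Rightarrow> 'y measure \<Rightarrow> ('w \<Rightarrow> 'x) \<Rightarrow> ('w \<Rightarrow> 'y) \<Rightarrow> ('x \<Rightarrow> 'y measure) \<Rightarrow> bool" where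
  "regular_cond_dist M MX MY X Y \<kappa> \<longleftrightarrow>
     \<kappa> \<in> MX \<rightarrow>\<^sub>M prob_algebra MY \<and>
     (\<forall>A\<in>sets MX. \<forall>B\<in>sets MY.
        emeasure M {\<omega> \<in> space M. X \<omega> \<in> A \<and> Y \<omega> \<in> B} =
        (\<integral>\<^sup>+x\<in>A. emeasure (\<kappa> x) B \<partial>distr M MX X))"

definition finite_cond_second_moment ::
  "'x measure \<Rightarrow> ('x \<Rightarrow> 'y measure) \<Rightarrow> ('y \<Rightarrow> 'g::real_normed_vector) \<Rightarrow> 'x set" where
  "finite_cond_second_moment MX \<kappa> \<psi> =
     {x \<in> space MX. (\<integral>\<^sup>+y. ennreal ((norm (\<psi> y))\<^sup>2) \<partial>\<kappa> x) < \<infinity>}"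

text \<open>\<open>x \<mapsto> E[u(Y) | X = x]\<close>, set to zero where the conditional second moment of \<open>\<psi>(Y)\<close> is
  infinite. The choice \<open>u = \<psi>\<close> gives the conditional mean embedding \<open>\<mu>\<close>, and \<open>u = val g\<close>
  gives the real function \<open>f\<^sub>g\<close>.\<close>
definition cond_mean ::
  "'x measure \<Rightarrow> ('x \<Rightarrow> 'y measure) \<Rightarrow> ('y \<Rightarrow> 'g::real_normed_vector) \<Rightarrow>
   ('y \<Rightarrow> 'b::{banach, second_countable_topology}) \<Rightarrow> 'x \<Rightarrow> 'b" where
  "cond_mean MX \<kappa> \<psi> u x =
     (if x \<in> finite_cond_second_moment MX \<kappa> \<psi> then (\<integral>y. u y \<partial>\<kappa> x) else 0)"

definition sq_integrable :: "'x measure \<Rightarrow> ('x \<Rightarrow> real) set" where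
  "sq_integrable Q = {f \<in> borel_measurable Q. integrable Q (\<lambda>x. (f x)\<^sup>2)}"

definition l2_inner :: "'x measure \<Rightarrow> ('x \<Rightarrow> real) \<Rightarrow> ('x \<Rightarrow> real) \<Rightarrow> real" where
  "l2_inner Q f g = (\<integral>x. f x * g x \<partial>Q)"

definition l2_norm :: "'x measure \<Rightarrow> ('x \<Rightarrow> real) \<Rightarrow> real" where
  "l2_norm Q f = sqrt (l2_inner Q f f)"

definition dense_in_l2 :: "'x measure \<Rightarrow> ('x \<Rightarrow> real) set \<Rightarrow> bool" where
  "dense_in_l2 Q H \<longleftrightarrow> H \<subseteq> sq_integrable Q \<and>
     (\<forall>f\<in>sq_integrable Q. \<forall>\<epsilon>>0. \<exists>h\<in>H. l2_norm Q (\<lambda>x. f x - h x) < \<epsilon>)"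

definition l2_universal ::
  "'x measure \<Rightarrow> ('x \<Rightarrow> 'x \<Rightarrow> real) \<Rightarrow> ('h \<Rightarrow> 'x \<Rightarrow> real) \<Rightarrow> bool" where
  "l2_universal MX k val \<longleftrightarrow>
     (\<lambda>(x, x'). k x x') \<in> borel_measurable (MX \<Otimes>\<^sub>M MX) \<and>
     (\<exists>C. \<forall>x\<in>space MX. \<forall>x'\<in>space MX. \<bar>k x x'\<bar> \<le> C) \<and>
     (\<forall>Q. prob_space Q \<and> sets Q = sets MX \<longrightarrow> dense_in_l2 Q (range val))"

definition ae_in_rkhs :: "'x measure \<Rightarrow> ('h \<Rightarrow> 'x \<Rightarrow> real) \<Rightarrow> ('x \<Rightarrow> real) \<Rightarrow> bool" where
  "ae_in_rkhs Q val f \<longleftrightarrow> (\<exists>h. AE x in Q. f x = val h x)"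

lift_definition tensor_op ::
  "'g::real_inner \<Rightarrow> 'h::real_inner \<Rightarrow> ('h \<Rightarrow>\<^sub>L 'g)" is "\<lambda>g h h'. (h \<bullet> h') *\<^sub>R g"
  by (rule bounded_linear_compose[OF bounded_linear_scaleR_left bounded_linear_inner_right])

text \<open>
  The library's Bochner integral is restricted to second countable spaces, which the space
  \<open>'h \<Rightarrow>\<^sub>L 'g\<close> with the operator norm is not in infinite dimensions, even for separable
  \<open>'h\<close> and \<open>'g\<close>. This is \<open>has_bochner_integral\<close> without that sort constraint; the
  approximation by simple functions makes \<open>f\<close> almost everywhere separably valued.
\<close>
definition has_operator_integral :: "'w measure \<Rightarrow> ('w \<Rightarrow> 'b::real_normed_vector) \<Rightarrow> 'b \<Rightarrow> bool" where
  "has_operator_integral M f I \<longleftrightarrow> f \<in> borel_measurable M \<and>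
     (\<exists>s. (\<forall>i::nat. Bochner_Integration.simple_bochner_integrable M (s i)) \<and>
          (\<lambda>i. \<integral>\<^sup>+\<omega>. ennreal (norm (f \<omega> - s i \<omega>)) \<partial>M) \<longlonglongrightarrow> 0 \<and>
          (\<lambda>i. Bochner_Integration.simple_bochner_integral M (s i)) \<longlonglongrightarrow> I)"

definition uncentred_cov ::
  "'w measure \<Rightarrow> ('w \<Rightarrow> 'g::{real_inner, banach}) \<Rightarrow> ('w \<Rightarrow> 'h::{real_inner, banach}) \<Rightarrow> ('h \<Rightarrow>\<^sub>L 'g)" where
  "uncentred_cov M U V = (THE C. has_operator_integral M (\<lambda>\<omega>. tensor_op (U \<omega>) (V \<omega>)) C)"

definition op_kernel :: "('a::real_inner \<Rightarrow>\<^sub>L 'b::real_inner) \<Rightarrow> 'a set" where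
  "op_kernel A = {x. blinfun_apply A x = 0}"

definition op_range :: "('a::real_inner \<Rightarrow>\<^sub>L 'b::real_inner) \<Rightarrow> 'b set" where
  "op_range A = range (blinfun_apply A)"

definition pinv_dom :: "('a::real_inner \<Rightarrow>\<^sub>L 'b::real_inner) \<Rightarrow> 'b set" where
  "pinv_dom A = {r + s | r s. r \<in> op_range A \<and> s \<in> (op_range A)\<^sup>\<bottom>}"

text \<open>The inverse of \<open>A\<close> restricted to the orthogonal complement of its kernel, applied to the
  \<open>op_range A\<close> component of \<open>z\<close>. The value is meaningful only for \<open>z \<in> pinv_dom A\<close>.\<close>
definition pinv :: "('a::real_inner \<Rightarrow>\<^sub>L 'b::real_inner) \<Rightarrow> 'b \<Rightarrow> 'a" where
  "pinv A z = the_inv_into ((op_kernel A)\<^sup>\<bottom>) (blinfun_apply A)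
                (THE r. r \<in> op_range A \<and> z - r \<in> (op_range A)\<^sup>\<bottom>)"

end

theory Submission
  imports Defs
begin

text \<open>
  Everything is read off from two bilinear identities. Write \<open>C\<close> for the uncentred covariance of
  \<open>\<phi>(X)\<close> and \<open>D\<close> for that of \<open>\<phi>(X)\<close> with \<open>\<psi>(Y)\<close>. Testing the operator-valued Bochner integrals
  against vectors (\<open>uncentred_cov_inner\<close>) gives
  \<open>\<langle>C h, h'\<rangle> = \<integral> h h' dP\<^sub>X\<close> and \<open>\<langle>D g, h\<rangle> = E[g(Y) h(X)]\<close>. The joint law of \<open>(X, Y)\<close> is the mixture
  of the laws \<open>\<kappa> x\<close> over \<open>P\<^sub>X\<close> (\<open>joint_law_eq_bind\<close>), so conditioning on \<open>X\<close> turns the second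
  identity into \<open>\<langle>D g, h\<rangle> = \<integral> f\<^sub>g h dP\<^sub>X\<close>, where \<open>f\<^sub>g x = \<langle>\<mu> x, g\<rangle>\<close> (\<open>expectation_mult_cond_mean\<close>,
  \<open>cond_mean_inner\<close>).

  The assumption on \<open>h\<^sub>g\<close> therefore says exactly that \<open>C h\<^sub>g = D g\<close>. Since \<open>\<langle>C h, h\<rangle>\<close> is the squared
  \<open>L\<^sup>2\<close> norm of \<open>h\<close> and an RKHS function that vanishes \<open>P\<^sub>X\<close>-almost everywhere is zero, the operator \<open>C\<close> is
  injective as well as self-adjoint; its pseudo-inverse undoes it on its range, and \<open>T g = h\<^sub>g\<close>. Boundedness of \<open>T\<close> is a closed graph argument: the range of \<open>C\<close> is
  dense, so \<open>norm (T g) \<le> r\<close> can be expressed through \<open>D g\<close> alone by closed conditions, and the Baire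
  category theorem applies (\<open>bounded_linear_factor_through_selfadjoint\<close>). The first identity of the
  theorem is the assumption on \<open>h\<^sub>g\<close> for \<open>g = \<psi> y\<close>, rewritten with
  \<open>\<langle>adjoint T (\<phi> x), \<psi> y\<rangle> = \<langle>\<phi> x, T (\<psi> y)\<rangle>\<close>.

  For the pointwise formula, each of the four conditions upgrades orthogonality of \<open>f\<^sub>g - h\<^sub>g\<close> to the
  RKHS into \<open>f\<^sub>g = h\<^sub>g\<close> almost everywhere for \<open>g = \<psi> y\<close>: by density
  (\<open>AE_zero_if_orthogonal_to_dense\<close>), or because \<open>f\<^sub>g\<close> has a representative in the RKHS, which
  injectivity of \<open>C\<close> forces to be \<open>h\<^sub>g\<close>. The null set depends on \<open>y\<close>, but by separability countably
  many features \<open>\<psi> y\<close> are dense among all of them, and a vector orthogonal to every feature vanishes.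
\<close>

section \<open>Orthogonality in Hilbert spaces\<close>

text \<open>
  By the parallelogram law a norm-minimising sequence in a convex set is Cauchy. This is the only place
  where completeness enters the geometry; density and Riesz representation below both follow from it.
\<close>
lemma closed_convex_has_min_norm:
  fixes S :: "'a::{real_inner, banach} set"
  assumes "closed S" "convex S" "S \<noteq> {}"
  obtains a where "a \<in> S" "\<And>y. y \<in> S \<Longrightarrow> norm a \<le> norm y"
proof -
  \<comment> \<open>The infimum of the squared norms fits the parallelogram law without square roots.\<close>
  define D where "D = Inf ((\<lambda>x. (norm x)\<^sup>2) ` S)"
  have bdd: "bdd_below ((\<lambda>x. (norm x)\<^sup>2) ` S)"
    by (rule bdd_belowI[of _ 0]) auto
  have D_le: "D \<le> (norm y)\<^sup>2" if "y \<in> S" for y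
    unfolding D_def using bdd that by (intro cInf_lower) auto
  have "\<exists>x\<in>S. (norm x)\<^sup>2 < D + 1 / Suc n" for n :: nat
    using cInf_lessD[of "(\<lambda>x. (norm x)\<^sup>2) ` S" "D + 1 / Suc n"] assms(3)
    by (auto simp: D_def)
  then obtain x where xS: "\<And>n. x n \<in> S" and x: "\<And>n::nat. (norm (x n))\<^sup>2 < D + 1 / Suc n"
    by metis
  have par: "(norm (x m - x n))\<^sup>2 \<le> 2 / Suc m + 2 / Suc n" for m n
  proof -
    have "(1/2) *\<^sub>R x m + (1/2) *\<^sub>R x n \<in> S"
      using assms(2) xS by (intro convexD) auto
    then have "D \<le> (norm ((1/2) *\<^sub>R x m + (1/2) *\<^sub>R x n))\<^sup>2"
      by (rule D_le)
    moreover have "(norm (x m - x n))\<^sup>2 =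
        2 * (norm (x m))\<^sup>2 + 2 * (norm (x n))\<^sup>2 - 4 * (norm ((1/2) *\<^sub>R x m + (1/2) *\<^sub>R x n))\<^sup>2"
      by (simp add: power2_norm_eq_inner inner_simps inner_commute algebra_simps)
    ultimately show ?thesis
      using x[of m] x[of n] by simp
  qed
  have "Cauchy x"
  proof (rule metric_CauchyI)
    fix e :: real assume e: "0 < e"
    obtain N :: nat where N: "1 / Suc N < e\<^sup>2 / 4"
      using nat_approx_posE[of "e\<^sup>2 / 4"] e by auto
    have "dist (x m) (x n) < e" if "m \<ge> N" "n \<ge> N" for m n
    proof -
      have "1 / real (Suc m) \<le> 1 / Suc N" "1 / real (Suc n) \<le> 1 / Suc N"
        using that by (auto simp: field_simps)
      then have "(norm (x m - x n))\<^sup>2 < e\<^sup>2"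
        using par[of m n] N by simp
      then show ?thesis
        using e by (simp add: dist_norm power2_less_imp_less)
    qed
    then show "\<exists>M. \<forall>m\<ge>M. \<forall>n\<ge>M. dist (x m) (x n) < e"
      by blast
  qed
  then obtain a where a: "x \<longlonglongrightarrow> a"
    using Cauchy_convergent convergent_def by blast
  have "a \<in> S"
    using closed_sequentially[OF assms(1) _ a] xS by blast
  moreover have "norm a \<le> norm y" if "y \<in> S" for y
  proof -
    have "(\<lambda>n. D + 1 / real (Suc n)) \<longlonglongrightarrow> D + 0"
      by (intro tendsto_intros LIMSEQ_Suc[OF lim_1_over_n])
    moreover have "(\<lambda>n. (norm (x n))\<^sup>2) \<longlonglongrightarrow> (norm a)\<^sup>2"
      using a by (intro tendsto_intros)
    ultimately have "(norm a)\<^sup>2 \<le> D + 0"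
      using x by (intro LIMSEQ_le[of _ "(norm a)\<^sup>2"]) (auto intro: less_imp_le)
    then have "(norm a)\<^sup>2 \<le> (norm y)\<^sup>2"
      using D_le[OF that] by linarith
    then show ?thesis
      by (rule power2_le_imp_le) simp
  qed
  ultimately show ?thesis
    by (rule that)
qed

text \<open>
  First-order optimality: the quadratic in \<open>t\<close> obtained by expanding the squared norm would be negative
  at its minimiser unless its linear coefficient vanished.
\<close>
lemma min_norm_imp_orthogonal:
  fixes a :: "'a::real_inner"
  assumes "\<And>t. norm a \<le> norm (a + t *\<^sub>R v)"
  shows "a \<bullet> v = 0"
proof (cases "v = 0")
  case False
  then have v: "v \<bullet> v > 0"
    by simp
  define t where "t = - (a \<bullet> v) / (v \<bullet> v)"
  have "(norm a)\<^sup>2 \<le> (norm (a + t *\<^sub>R v))\<^sup>2"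
    using assms by (simp add: power_mono)
  also have "\<dots> = (norm a)\<^sup>2 + (2 * t * (a \<bullet> v) + t * t * (v \<bullet> v))"
    by (simp add: power2_norm_eq_inner inner_simps inner_commute algebra_simps)
  also have "2 * t * (a \<bullet> v) + t * t * (v \<bullet> v) = - ((a \<bullet> v)\<^sup>2 / (v \<bullet> v))"
    using v by (simp add: t_def field_simps power2_eq_square)
  finally have "(a \<bullet> v)\<^sup>2 / (v \<bullet> v) \<le> 0"
    by simp
  then show ?thesis
    using v by (simp add: divide_le_0_iff)
qed simp

text \<open>
  If \<open>x\<close> were outside the closure, the element of least norm in the translate of the closure by \<open>x\<close>
  would be orthogonal to \<open>V\<close>, hence zero, which puts \<open>x\<close> into the closure.
\<close>
lemma dense_subspaceI:
  fixes V :: "'a::{real_inner, banach} set"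
  assumes "subspace V" and ortho: "\<And>z. (\<And>v. v \<in> V \<Longrightarrow> z \<bullet> v = 0) \<Longrightarrow> z = 0"
  shows "closure V = UNIV"
proof (rule ccontr)
  assume "closure V \<noteq> UNIV"
  then obtain x where x: "x \<notin> closure V"
    by blast
  have translate: "u + w \<in> closure V" if "u \<in> V" "w \<in> closure V" for u w
  proof -
    have "(+) u ` V \<subseteq> V"
      using assms(1) that(1) by (auto intro: subspace_add)
    then have "(+) u ` closure V \<subseteq> closure V"
      unfolding closure_translation[symmetric] by (rule closure_mono)
    then show ?thesis
      using that(2) by blast
  qed
  have "closed ((+) x ` closure V)"
    by (intro closed_translation closed_closure)
  moreover have "convex ((+) x ` closure V)"
    using assms(1) by (intro convex_translation convex_closure subspace_imp_convex)
  moreover have "(+) x ` closure V \<noteq> {}"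
    using subspace_0[OF assms(1)] by auto
  ultimately obtain a where a: "a \<in> (+) x ` closure V" "\<And>y. y \<in> (+) x ` closure V \<Longrightarrow> norm a \<le> norm y"
    using closed_convex_has_min_norm by blast
  then obtain w where w: "w \<in> closure V" "a = x + w"
    by blast
  have "a \<bullet> v = 0" if "v \<in> V" for v
  proof (rule min_norm_imp_orthogonal)
    fix t
    have "t *\<^sub>R v + w \<in> closure V"
      using w that assms(1) by (intro translate subspace_scale)
    then show "norm a \<le> norm (a + t *\<^sub>R v)"
      unfolding w by (intro a(2)[unfolded w]) (auto simp: ac_simps intro!: image_eqI)
  qed
  then have "a = 0"
    using ortho by blast
  then have "x = (-1) *\<^sub>R w"
    using w by (simp add: eq_neg_iff_add_eq_0)
  moreover have "(-1) *\<^sub>R w \<in> closure V"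
  proof -
    have "(*\<^sub>R) (-1) ` V \<subseteq> V"
      using assms(1) by (auto dest: subspace_neg)
    then have "(*\<^sub>R) (-1) ` closure V \<subseteq> closure V"
      unfolding closure_scaleR[symmetric] by (metis closure_mono closure_scaleR)
    then show ?thesis
      using w by blast
  qed
  ultimately show False
    using x by simp
qed

text \<open>
  The representing vector is a multiple of the element of least norm in the hyperplane \<open>f x = 1\<close>,
  which is orthogonal to the kernel of \<open>f\<close>.
\<close>
lemma riesz_representation:
  fixes f :: "'a::{real_inner, banach} \<Rightarrow> real"
  assumes "bounded_linear f"
  obtains a where "\<And>x. f x = x \<bullet> a"
proof (cases "\<forall>x. f x = 0")
  case True
  then show ?thesis
    using that[of 0] by simp
next
  case False
  interpret f: bounded_linear f
    by fact
  obtain z where z: "f z \<noteq> 0"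
    using False by blast
  have "closed {x. f x = 1}"
    by (intro closed_Collect_eq f.continuous_on continuous_intros)
  moreover have "convex {x. f x = 1}"
    unfolding convex_def by (auto simp: f.add f.scale)
  moreover have "z /\<^sub>R f z \<in> {x. f x = 1}"
    using z by (simp add: f.scale)
  ultimately obtain a where a: "f a = 1" "\<And>y. f y = 1 \<Longrightarrow> norm a \<le> norm y"
    using closed_convex_has_min_norm[of "{x. f x = 1}"] by auto
  have orth: "a \<bullet> v = 0" if "f v = 0" for v
    by (rule min_norm_imp_orthogonal) (auto intro!: a(2) simp: f.add f.scale a(1) that)
  have "a \<noteq> 0"
    using a(1) f.zero by auto
  show ?thesis
  proof
    fix x
    have "a \<bullet> (x - f x *\<^sub>R a) = 0"
      by (rule orth) (simp add: f.diff f.scale a(1))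
    then show "f x = x \<bullet> (a /\<^sub>R (a \<bullet> a))"
      using \<open>a \<noteq> 0\<close> by (simp add: inner_simps inner_commute field_simps)
  qed
qed

text \<open>
  The constant \<open>adjoint\<close> is a choice among all maps with the adjoint property; in infinite dimensions
  Riesz representation shows that there is something to choose.
\<close>
lemma inner_adjoint:
  fixes T :: "'a::{real_inner, banach} \<Rightarrow> 'b::real_inner"
  assumes "bounded_linear T"
  shows "x \<bullet> adjoint T y = T x \<bullet> y"
proof -
  have "\<exists>a. \<forall>x. T x \<bullet> y = x \<bullet> a" for y
    using riesz_representation[OF bounded_linear_inner_left_comp[OF assms], of y] by metis
  then have "\<exists>T'. \<forall>x y. T x \<bullet> y = x \<bullet> T' y"
    by metis
  from someI_ex[OF this] have "\<forall>x y. T x \<bullet> y = x \<bullet> adjoint T y"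
    unfolding adjoint_def .
  then show ?thesis
    by metis
qed

section \<open>Factoring through an injective self-adjoint operator\<close>

text \<open>
  The sublevel sets exhaust the space, so by Baire one of them contains a ball; differences of points in
  that ball then bound the map near the origin.
\<close>
lemma bounded_linear_if_closed_sublevels:
  fixes T :: "'a::banach \<Rightarrow> 'b::real_normed_vector"
  assumes "linear T" and closed: "\<And>r. closed {x. norm (T x) \<le> r}"
  shows "bounded_linear T"
proof -
  interpret T: linear T
    by fact
  define \<G> where "\<G> = range (\<lambda>n::nat. {x. norm (T x) \<le> real n})"
  have "\<Union>\<G> = UNIV"
    by (auto simp: \<G>_def real_arch_simple)
  then have "interior (\<Union>\<G>) \<noteq> {}"
    by simp
  moreover have "interior (\<Union>\<G>) = {}" if "\<And>n::nat. interior {x. norm (T x) \<le> real n} = {}"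
  proof -
    have "euclidean interior_of \<Union>\<G> = {}"
    proof (rule Baire_category_alt)
      show "countable \<G>"
        by (simp add: \<G>_def)
      show "closedin euclidean S \<and> euclidean interior_of S = {}" if "S \<in> \<G>" for S
        using that closed \<open>\<And>n::nat. interior {x. norm (T x) \<le> real n} = {}\<close>
        unfolding \<G>_def by fastforce
    qed (simp add: completely_metrizable_space_euclidean)
    then show ?thesis
      by simp
  qed
  ultimately obtain n :: nat where "interior {x. norm (T x) \<le> real n} \<noteq> {}"
    by blast
  then obtain a where "a \<in> interior {x. norm (T x) \<le> real n}"
    by blast
  then obtain e where e: "0 < e" "cball a e \<subseteq> {x. norm (T x) \<le> real n}"
    unfolding mem_interior_cball by blast
  show ?thesis
  proof (rule bounded_linear_intro[of _ "2 * n / e"])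
    fix x y r
    show "T (x + y) = T x + T y" "T (r *\<^sub>R x) = r *\<^sub>R T x"
      by (simp_all add: T.add T.scale)
    show "norm (T x) \<le> norm x * (2 * n / e)"
    proof (cases "x = 0")
      case False
      \<comment> \<open>Rescaling \<open>x\<close> to length \<open>e\<close> keeps \<open>a + y\<close> in the closed ball around \<open>a\<close>, hence in the sublevel set.\<close>
      define y where "y = (e / norm x) *\<^sub>R x"
      have "a + y \<in> cball a e" "a \<in> cball a e"
        using False e by (auto simp: y_def dist_norm)
      then have "norm (T (a + y)) \<le> n" "norm (T a) \<le> n"
        using e(2) by blast+
      then have "norm (T (a + y) - T a) \<le> 2 * n"
        using norm_triangle_ineq4[of "T (a + y)" "T a"] by linarith
      then have "e / norm x * norm (T x) \<le> 2 * n"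
        using e by (simp add: T.add y_def T.scale)
      then show ?thesis
        using False e by (simp add: field_simps)
    qed (simp add: T.zero)
  qed
qed

context
  fixes A :: "'h::{real_inner, banach} \<Rightarrow>\<^sub>L 'h"
  assumes selfadj: "\<And>x y. A x \<bullet> y = x \<bullet> A y"
    and inj: "\<And>x. A x = 0 \<Longrightarrow> x = 0"
begin

lemma selfadjoint_range_ortho: "(op_range A)\<^sup>\<bottom> = {0}"
proof -
  have "z = 0" if "\<And>x. A x \<bullet> z = 0" for z
    using that[of "A z"] selfadj[of "A z" z] inj[of z] by simp
  then show ?thesis
    by (auto simp: op_range_def orthogonal_comp_def orthogonal_def)
qed

text \<open>
  For a self-adjoint operator the orthogonal complement of the range is the kernel.
\<close>
lemma selfadjoint_dense_range: "closure (op_range A) = UNIV"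
proof (rule dense_subspaceI)
  show "subspace (op_range A)"
    unfolding op_range_def
    by (intro linear_subspace_image bounded_linear.linear blinfun.bounded_linear_right subspace_UNIV)
  fix z assume "\<And>v. v \<in> op_range A \<Longrightarrow> z \<bullet> v = 0"
  then have "z \<in> (op_range A)\<^sup>\<bottom>"
    by (auto simp: orthogonal_comp_def orthogonal_def inner_commute)
  then show "z = 0"
    by (simp add: selfadjoint_range_ortho)
qed

lemma pinv_selfadjoint_injective: "pinv A (A x) = x"
proof -
  have A_range: "A x \<in> op_range A"
    by (simp add: op_range_def)
  have "(THE r. r \<in> op_range A \<and> A x - r \<in> (op_range A)\<^sup>\<bottom>) = A x"
    by (rule the_equality) (simp_all add: A_range selfadjoint_range_ortho)
  moreover have "op_kernel A = {0}"
    using inj by (auto simp: op_kernel_def)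
  moreover have "inj (blinfun_apply A)"
    using inj by (metis (no_types, opaque_lifting) blinfun.diff_right eq_iff_diff_eq_0 injI)
  ultimately show ?thesis
    by (simp add: pinv_def the_inv_f_f)
qed

text \<open>
  Testing \<open>T g\<close> against the dense range of \<open>A\<close> gives \<open>\<langle>T g, A h\<rangle> = \<langle>B g, h\<rangle>\<close>. Thus
  \<open>norm (T g) \<le> r\<close> holds iff \<open>\<bar>\<langle>B g, h\<rangle>\<bar> \<le> r * norm (A h)\<close> for all \<open>h\<close>, and these conditions are
  closed in \<open>g\<close> because \<open>B\<close> is continuous.
\<close>
lemma bounded_linear_factor_through_selfadjoint:
  fixes B :: "'g::banach \<Rightarrow>\<^sub>L 'h"
  assumes T: "\<And>g. A (T g) = B g"
  shows "bounded_linear T"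
proof (rule bounded_linear_if_closed_sublevels)
  have A_inj: "x = y" if "A x = A y" for x y
    using inj[of "x - y"] that by (simp add: blinfun.diff_right)
  show "linear T"
    by (rule linearI; rule A_inj) (simp_all add: T blinfun.add_right blinfun.scaleR_right)
  fix r :: real
  show "closed {g. norm (T g) \<le> r}"
  proof (cases "r < 0")
    case True
    then have "{g. norm (T g) \<le> r} = {}"
      by (auto simp: not_le intro: less_le_trans)
    then show ?thesis
      by simp
  next
    case False
    have "norm (T g) \<le> r \<longleftrightarrow> (\<forall>h. \<bar>B g \<bullet> h\<bar> \<le> r * norm (A h))" for g
    proof
      assume "norm (T g) \<le> r"
      then have "\<bar>T g \<bullet> A h\<bar> \<le> r * norm (A h)" for h
        using Cauchy_Schwarz_ineq2[of "T g" "A h"] mult_right_mono[of "norm (T g)" r "norm (A h)"]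
        by simp
      then show "\<forall>h. \<bar>B g \<bullet> h\<bar> \<le> r * norm (A h)"
        by (simp flip: T add: selfadj)
    next
      assume *: "\<forall>h. \<bar>B g \<bullet> h\<bar> \<le> r * norm (A h)"
      have "closed {z. \<bar>T g \<bullet> z\<bar> \<le> r * norm z}"
        by (intro closed_Collect_le continuous_intros)
      moreover have "op_range A \<subseteq> {z. \<bar>T g \<bullet> z\<bar> \<le> r * norm z}"
        using * by (auto simp: op_range_def simp flip: T selfadj)
      ultimately have "closure (op_range A) \<subseteq> {z. \<bar>T g \<bullet> z\<bar> \<le> r * norm z}"
        by (intro closure_minimal)
      then have "\<bar>T g \<bullet> T g\<bar> \<le> r * norm (T g)"
        using selfadjoint_dense_range by blast
      then have "norm (T g) * norm (T g) \<le> r * norm (T g)"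
        by (simp add: power2_norm_eq_inner flip: power2_eq_square)
      then show "norm (T g) \<le> r"
        using False by (cases "T g = 0") auto
    qed
    then have "{g. norm (T g) \<le> r} = (\<Inter>h. {g. \<bar>B g \<bullet> h\<bar> \<le> r * norm (A h)})"
      by auto
    also have "closed \<dots>"
      by (intro closed_INT ballI closed_Collect_le continuous_intros)
    finally show ?thesis .
  qed
qed

end

section \<open>Operator-valued integrals and covariances\<close>

text \<open>
  Pettis' theorem in the separable case. The norm is a supremum over a countable dense set of functionals,
  so preimages of closed balls are measurable, and every open set is a countable union of closed balls.
\<close>
lemma borel_measurable_weak:
  fixes f :: "'a \<Rightarrow> 'b::{real_inner, second_countable_topology}"
  assumes [measurable]: "\<And>h. (\<lambda>x. f x \<bullet> h) \<in> borel_measurable M"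
  shows "f \<in> borel_measurable M"
proof -
  obtain D :: "'b set" where D: "countable D" "\<And>U. open U \<Longrightarrow> U \<noteq> {} \<Longrightarrow> \<exists>d\<in>D. d \<in> U"
    by (erule countable_dense_setE)
  have norm_le: "norm v \<le> r \<longleftrightarrow> (\<forall>d\<in>D. v \<bullet> d \<le> r * norm d)" if "0 \<le> r" for v :: 'b and r
  proof
    assume "norm v \<le> r"
    then show "\<forall>d\<in>D. v \<bullet> d \<le> r * norm d"
      using norm_cauchy_schwarz[of v] mult_right_mono[of "norm v" r "norm d" for d]
      by (meson norm_ge_zero order_trans)
  next
    assume *: "\<forall>d\<in>D. v \<bullet> d \<le> r * norm d"
    have "closed {z. v \<bullet> z \<le> r * norm z}"
      by (intro closed_Collect_le continuous_intros)
    then have "open (- {z. v \<bullet> z \<le> r * norm z})"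
      by (rule open_Compl)
    then have "- {z. v \<bullet> z \<le> r * norm z} = {}"
      using D(2) * by blast
    then have "v \<bullet> v \<le> r * norm v"
      by blast
    then have "norm v * norm v \<le> r * norm v"
      by (simp add: power2_norm_eq_inner flip: power2_eq_square)
    then show "norm v \<le> r"
      using that by (cases "v = 0") auto
  qed
  have cball: "f -` cball a r \<inter> space M \<in> sets M" for a r
  proof (cases "0 \<le> r")
    case True
    have "f -` cball a r \<inter> space M = {x \<in> space M. \<forall>d\<in>D. f x \<bullet> d - a \<bullet> d \<le> r * norm d}"
    proof -
      have "f x \<in> cball a r \<longleftrightarrow> (\<forall>d\<in>D. f x \<bullet> d - a \<bullet> d \<le> r * norm d)" for x
        using norm_le[OF True, of "f x - a"] by (simp add: dist_norm norm_minus_commute inner_diff_left)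
      then show ?thesis
        by auto
    qed
    also have "\<dots> \<in> sets M"
      using D(1) by measurable
    finally show ?thesis .
  next
    case False
    then have "cball a r = {}"
      by simp
    then show ?thesis
      by simp
  qed
  show ?thesis
  proof (rule borel_measurableI)
    fix U :: "'b set" assume U: "open U"
    define I where "I = {(a, q). a \<in> D \<and> cball a (real_of_rat q) \<subseteq> U}"
    have "countable I"
      unfolding I_def by (rule countable_subset[of _ "D \<times> UNIV"]) (use D(1) in auto)
    have "U = (\<Union>(a, q)\<in>I. cball a (real_of_rat q))"
    proof (rule antisym)
      show "(\<Union>(a, q)\<in>I. cball a (real_of_rat q)) \<subseteq> U"
        by (auto simp: I_def)
      show "U \<subseteq> (\<Union>(a, q)\<in>I. cball a (real_of_rat q))"
      proof
        fix x assume "x \<in> U"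
        then obtain e where e: "e > 0" "ball x e \<subseteq> U"
          using U open_contains_ball by blast
        obtain q where q: "0 < real_of_rat q" "real_of_rat q < e / 2"
          using of_rat_dense[of 0 "e / 2"] e by auto
        obtain a where a: "a \<in> D" "dist x a < real_of_rat q"
          using D(2)[of "ball x (real_of_rat q)"] q by auto
        have "cball a (real_of_rat q) \<subseteq> ball x e"
        proof
          fix y assume "y \<in> cball a (real_of_rat q)"
          then show "y \<in> ball x e"
            using dist_triangle[of x y a] a q by simp
        qed
        then have "(a, q) \<in> I"
          using a e by (auto simp: I_def)
        moreover have "x \<in> cball a (real_of_rat q)"
          using a by (simp add: dist_commute)
        ultimately show "x \<in> (\<Union>(a, q)\<in>I. cball a (real_of_rat q))"
          by blast
      qed
    qed
    then have "f -` U \<inter> space M = (\<Union>p\<in>I. f -` cball (fst p) (real_of_rat (snd p)) \<inter> space M)"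
      by (auto simp: case_prod_beta)
    also have "\<dots> \<in> sets M"
      using \<open>countable I\<close> cball by (intro sets.countable_UN') auto
    finally show "f -` U \<inter> space M \<in> sets M" .
  qed
qed

text \<open>
  Differences of Borel functions need not be Borel when the space is not second countable, and the
  space of bounded operators is not. Here the simple function takes finitely many values, and on each of
  its level sets the difference is \<open>f\<close> translated by a constant.
\<close>
lemma borel_measurable_norm_diff_simple:
  fixes f :: "'a \<Rightarrow> 'b::real_normed_vector"
  assumes f[measurable]: "f \<in> borel_measurable M" and s: "simple_function M s"
  shows "(\<lambda>x. norm (f x - s x)) \<in> borel_measurable M"
proof (rule measurable_compose_countable'[where g = s and I = "s ` space M"
      and f = "\<lambda>y x. norm (f x - y)"])
  fix y :: 'b
  have "(\<lambda>z. norm (z - y)) \<in> borel_measurable borel"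
    by (intro borel_measurable_continuous_onI continuous_intros)
  from measurable_compose[OF f this] show "(\<lambda>x. norm (f x - y)) \<in> borel_measurable M" .
next
  show "countable (s ` space M)"
    using s by (simp add: simple_function_def countable_finite)
  show "s \<in> M \<rightarrow>\<^sub>M count_space (s ` space M)"
    using s by (auto simp: simple_function_def intro!: measurable_count_space_eq2[THEN iffD2])
qed

text \<open>
  Evaluation at \<open>h\<close> is a bounded linear map and so carries approximating simple functions to approximating
  simple functions. This reduces operator integrals to vector integrals, and gives their uniqueness.
\<close>
lemma has_operator_integral_apply:
  fixes f :: "'w \<Rightarrow> 'a::real_normed_vector \<Rightarrow>\<^sub>L 'b::{real_normed_vector, second_countable_topology}"
  assumes "has_operator_integral M f I"
  shows "has_bochner_integral M (\<lambda>\<omega>. f \<omega> h) (I h)"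
proof -
  obtain s where f: "f \<in> borel_measurable M"
    and s: "\<And>i::nat. Bochner_Integration.simple_bochner_integrable M (s i)"
    and lim: "(\<lambda>i. \<integral>\<^sup>+\<omega>. ennreal (norm (f \<omega> - s i \<omega>)) \<partial>M) \<longlonglongrightarrow> 0"
    and I: "(\<lambda>i. Bochner_Integration.simple_bochner_integral M (s i)) \<longlonglongrightarrow> I"
    using assms unfolding has_operator_integral_def by blast
  have sf: "simple_function M (s i)" for i
    using s[of i] by (auto elim: Bochner_Integration.simple_bochner_integrable.cases)
  have lin: "linear (\<lambda>A::'a \<Rightarrow>\<^sub>L 'b. blinfun_apply A h)"
    by (intro bounded_linear.linear bounded_linear_intros)
  show ?thesis
  proof
    have "(\<lambda>A::'a \<Rightarrow>\<^sub>L 'b. blinfun_apply A h) \<in> borel_measurable borel"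
      by (intro borel_measurable_continuous_onI continuous_intros)
    from measurable_compose[OF f this] show "(\<lambda>\<omega>. f \<omega> h) \<in> borel_measurable M" .
    show "Bochner_Integration.simple_bochner_integrable M (\<lambda>\<omega>. s i \<omega> h)" for i
      using Bochner_Integration.simple_bochner_integrable_compose2[of "\<lambda>A _. blinfun_apply A h", OF _ s s]
      by simp
    have "(\<lambda>i. blinfun_apply (Bochner_Integration.simple_bochner_integral M (s i)) h) \<longlonglongrightarrow> I h"
      using I by (intro tendsto_intros)
    then show "(\<lambda>i. Bochner_Integration.simple_bochner_integral M (\<lambda>\<omega>. s i \<omega> h)) \<longlonglongrightarrow> I h"
      by (simp add: Bochner_Integration.simple_bochner_integral_linear[OF lin s])
    have "(\<integral>\<^sup>+\<omega>. ennreal (norm (f \<omega> h - s i \<omega> h)) \<partial>M)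
        \<le> (\<integral>\<^sup>+\<omega>. ennreal (norm h) * ennreal (norm (f \<omega> - s i \<omega>)) \<partial>M)" for i
      using norm_blinfun[of "f \<omega> - s i \<omega>" h for \<omega>]
      by (intro nn_integral_mono)
        (simp add: blinfun.diff_left mult.commute flip: ennreal_mult)
    also have "(\<integral>\<^sup>+\<omega>. ennreal (norm h) * ennreal (norm (f \<omega> - s i \<omega>)) \<partial>M) =
        ennreal (norm h) * (\<integral>\<^sup>+\<omega>. ennreal (norm (f \<omega> - s i \<omega>)) \<partial>M)" for i
      using borel_measurable_norm_diff_simple[OF f sf]
      by (intro nn_integral_cmult) simp
    finally have le: "(\<integral>\<^sup>+\<omega>. ennreal (norm (f \<omega> h - s i \<omega> h)) \<partial>M) \<le>
        ennreal (norm h) * (\<integral>\<^sup>+\<omega>. ennreal (norm (f \<omega> - s i \<omega>)) \<partial>M)" for i .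
    have "(\<lambda>i. ennreal (norm h) * (\<integral>\<^sup>+\<omega>. ennreal (norm (f \<omega> - s i \<omega>)) \<partial>M)) \<longlonglongrightarrow> ennreal (norm h) * 0"
      using lim by (intro ennreal_tendsto_cmult) auto
    then have "(\<lambda>i. ennreal (norm h) * (\<integral>\<^sup>+\<omega>. ennreal (norm (f \<omega> - s i \<omega>)) \<partial>M)) \<longlonglongrightarrow> 0"
      by simp
    then show "(\<lambda>i. \<integral>\<^sup>+\<omega>. ennreal (norm (f \<omega> h - s i \<omega> h)) \<partial>M) \<longlonglongrightarrow> 0"
      by (rule tendsto_sandwich[OF always_eventually always_eventually tendsto_const, rotated 2])
        (simp_all add: le)
  qed
qed

text \<open>
  The integrals of the approximants form a Cauchy sequence: their distance is at most the sum of the two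
  \<open>L\<^sup>1\<close> distances to \<open>f\<close>.
\<close>
lemma has_operator_integral_exists:
  fixes f :: "'w \<Rightarrow> 'b::banach"
  assumes f: "f \<in> borel_measurable M"
    and s: "\<And>i::nat. Bochner_Integration.simple_bochner_integrable M (s i)"
    and lim: "(\<lambda>i. \<integral>\<^sup>+\<omega>. ennreal (norm (f \<omega> - s i \<omega>)) \<partial>M) \<longlonglongrightarrow> 0"
  shows "\<exists>I. has_operator_integral M f I"
proof -
  let ?S = "\<lambda>i. Bochner_Integration.simple_bochner_integral M (s i)"
  let ?d = "\<lambda>i. \<integral>\<^sup>+\<omega>. ennreal (norm (f \<omega> - s i \<omega>)) \<partial>M"
  have [measurable]: "(\<lambda>\<omega>. norm (f \<omega> - s i \<omega>)) \<in> borel_measurable M" for i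
    using s[of i] f
    by (auto elim!: Bochner_Integration.simple_bochner_integrable.cases
        intro: borel_measurable_norm_diff_simple)
  have le: "ennreal (norm (?S i - ?S j)) \<le> ?d i + ?d j" for i j
  proof -
    have diff: "Bochner_Integration.simple_bochner_integrable M (\<lambda>\<omega>. s i \<omega> - s j \<omega>)"
      using Bochner_Integration.simple_bochner_integrable_compose2[of "(-)", OF _ s s] by simp
    have "ennreal (norm (?S i - ?S j)) \<le>
        ennreal (Bochner_Integration.simple_bochner_integral M (\<lambda>\<omega>. norm (s i \<omega> - s j \<omega>)))"
      using Bochner_Integration.simple_bochner_integral_norm_bound[OF diff]
      by (simp add: Bochner_Integration.simple_bochner_integral_diff[OF s s])
    also have "\<dots> = (\<integral>\<^sup>+\<omega>. ennreal (norm (s i \<omega> - s j \<omega>)) \<partial>M)"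
      using Bochner_Integration.simple_bochner_integrable_compose2[of "\<lambda>x y. norm (x - y)", OF _ s s]
      by (intro Bochner_Integration.simple_bochner_integral_eq_nn_integral) auto
    also have "\<dots> \<le> (\<integral>\<^sup>+\<omega>. ennreal (norm (f \<omega> - s i \<omega>)) + ennreal (norm (f \<omega> - s j \<omega>)) \<partial>M)"
    proof (intro nn_integral_mono)
      fix \<omega>
      have "norm (s i \<omega> - s j \<omega>) \<le> norm (f \<omega> - s i \<omega>) + norm (f \<omega> - s j \<omega>)"
        using norm_triangle_ineq4[of "f \<omega> - s j \<omega>" "f \<omega> - s i \<omega>"] by (simp add: algebra_simps)
      then show "ennreal (norm (s i \<omega> - s j \<omega>)) \<le> ennreal (norm (f \<omega> - s i \<omega>)) + ennreal (norm (f \<omega> - s j \<omega>))"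
        by (simp flip: ennreal_plus)
    qed
    also have "\<dots> = ?d i + ?d j"
      by (intro nn_integral_add) auto
    finally show ?thesis .
  qed
  have "Cauchy ?S"
  proof (rule metric_CauchyI)
    fix e :: real assume e: "0 < e"
    then have "\<forall>\<^sub>F i in sequentially. ?d i < ennreal (e / 2)"
      using lim by (intro order_tendstoD(2)) auto
    then obtain N where N: "\<And>i. i \<ge> N \<Longrightarrow> ?d i < ennreal (e / 2)"
      by (auto simp: eventually_sequentially)
    have "dist (?S i) (?S j) < e" if "i \<ge> N" "j \<ge> N" for i j
    proof -
      have "ennreal (norm (?S i - ?S j)) < ennreal (e / 2) + ennreal (e / 2)"
        using le[of i j] add_strict_mono[OF N[OF that(1)] N[OF that(2)]] by (rule le_less_trans)
      then show ?thesis
        using e by (simp add: dist_norm ennreal_less_iff flip: ennreal_plus)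
    qed
    then show "\<exists>N. \<forall>i\<ge>N. \<forall>j\<ge>N. dist (?S i) (?S j) < e"
      by blast
  qed
  then obtain I where "?S \<longlonglongrightarrow> I"
    using Cauchy_convergent convergent_def by blast
  then show ?thesis
    using assms unfolding has_operator_integral_def by blast
qed

lemma norm_tensor_op_le: "norm (tensor_op a b) \<le> norm a * norm b"
proof (rule norm_blinfun_bound)
  fix x
  show "norm (blinfun_apply (tensor_op a b) x) \<le> norm a * norm b * norm x"
    using mult_left_mono[OF Cauchy_Schwarz_ineq2[of b x], of "norm a"]
    by (simp add: tensor_op.rep_eq ac_simps)
qed simp

lemma bounded_bilinear_tensor_op: "bounded_bilinear tensor_op"
proof
  fix a a' :: 'a and b b' :: 'b and r :: real
  show "tensor_op (a + a') b = tensor_op a b + tensor_op a' b"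
    by (rule blinfun_eqI) (simp add: tensor_op.rep_eq blinfun.add_left scaleR_add_right)
  show "tensor_op a (b + b') = tensor_op a b + tensor_op a b'"
    by (rule blinfun_eqI) (simp add: tensor_op.rep_eq blinfun.add_left inner_add_left scaleR_add_left)
  show "tensor_op (r *\<^sub>R a) b = r *\<^sub>R tensor_op a b"
    by (rule blinfun_eqI) (simp add: tensor_op.rep_eq blinfun.scaleR_left)
  show "tensor_op a (r *\<^sub>R b) = r *\<^sub>R tensor_op a b"
    by (rule blinfun_eqI) (simp add: tensor_op.rep_eq blinfun.scaleR_left)
next
  show "\<exists>K. \<forall>(a::'a) (b::'b). norm (tensor_op a b) \<le> norm a * norm b * K"
    by (rule exI[of _ 1]) (simp add: norm_tensor_op_le)
qed

text \<open>
  Tensoring simple approximations of \<open>U\<close> and \<open>V\<close> gives simple operator-valued functions, and dominated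
  convergence applies. Borel measurability of the tensor product comes from its joint continuity on the
  second countable product of the two factor spaces.
\<close>
lemma has_operator_integral_tensor_exists:
  fixes U :: "'w \<Rightarrow> 'g::{real_inner, banach, second_countable_topology}"
    and V :: "'w \<Rightarrow> 'h::{real_inner, banach, second_countable_topology}"
  assumes U[measurable]: "U \<in> borel_measurable M" and V[measurable]: "V \<in> borel_measurable M"
    and fin: "(\<integral>\<^sup>+\<omega>. ennreal (norm (U \<omega>) * norm (V \<omega>)) \<partial>M) < \<infinity>"
  shows "\<exists>C. has_operator_integral M (\<lambda>\<omega>. tensor_op (U \<omega>) (V \<omega>)) C"
proof -
  interpret tensor: bounded_bilinear "tensor_op :: 'g \<Rightarrow> 'h \<Rightarrow> _"
    by (rule bounded_bilinear_tensor_op)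
  obtain u where u: "\<And>i. simple_function M (u i)" "\<And>\<omega>. \<omega> \<in> space M \<Longrightarrow> (\<lambda>i. u i \<omega>) \<longlonglongrightarrow> U \<omega>"
      "\<And>i \<omega>. \<omega> \<in> space M \<Longrightarrow> norm (u i \<omega>) \<le> 2 * norm (U \<omega>)"
    using borel_measurable_implies_sequence_metric[OF U, of 0] by (simp add: dist_norm) blast
  obtain v where v: "\<And>i. simple_function M (v i)" "\<And>\<omega>. \<omega> \<in> space M \<Longrightarrow> (\<lambda>i. v i \<omega>) \<longlonglongrightarrow> V \<omega>"
      "\<And>i \<omega>. \<omega> \<in> space M \<Longrightarrow> norm (v i \<omega>) \<le> 2 * norm (V \<omega>)"
    using borel_measurable_implies_sequence_metric[OF V, of 0] by (simp add: dist_norm) blast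
  have fin': "(\<integral>\<^sup>+\<omega>. ennreal (c * (norm (U \<omega>) * norm (V \<omega>))) \<partial>M) < \<infinity>" if "0 \<le> c" for c
    using that fin by (simp add: ennreal_mult nn_integral_cmult ennreal_mult_less_top)
  have bound: "norm (tensor_op (u i \<omega>) (v i \<omega>)) \<le> 4 * (norm (U \<omega>) * norm (V \<omega>))"
    if "\<omega> \<in> space M" for i \<omega>
    using norm_tensor_op_le[of "u i \<omega>" "v i \<omega>"] mult_mono[OF u(3) v(3), OF that that, of i i] by simp
  have f: "(\<lambda>\<omega>. tensor_op (U \<omega>) (V \<omega>)) \<in> borel_measurable M"
    by (rule borel_measurable_continuous_Pair[OF U V]) (intro tensor.continuous_on continuous_intros)
  have sf: "simple_function M (\<lambda>\<omega>. tensor_op (u i \<omega>) (v i \<omega>))" for i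
    using u(1) v(1) by (rule simple_function_compose2)
  show ?thesis
  proof (rule has_operator_integral_exists[OF f])
    show "Bochner_Integration.simple_bochner_integrable M (\<lambda>\<omega>. tensor_op (u i \<omega>) (v i \<omega>))" for i
    proof (rule Bochner_Integration.simple_bochner_integrableI_bounded[OF sf])
      have "(\<integral>\<^sup>+\<omega>. ennreal (norm (tensor_op (u i \<omega>) (v i \<omega>))) \<partial>M) \<le>
          (\<integral>\<^sup>+\<omega>. ennreal (4 * (norm (U \<omega>) * norm (V \<omega>))) \<partial>M)"
        using bound by (intro nn_integral_mono ennreal_leI) auto
      then show "(\<integral>\<^sup>+\<omega>. ennreal (norm (tensor_op (u i \<omega>) (v i \<omega>))) \<partial>M) < \<infinity>"
        using fin'[of 4] by (simp add: le_less_trans)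
    qed
    have "(\<lambda>i. \<integral>\<^sup>+\<omega>. ennreal (norm (tensor_op (U \<omega>) (V \<omega>) - tensor_op (u i \<omega>) (v i \<omega>))) \<partial>M)
        \<longlonglongrightarrow> (\<integral>\<^sup>+\<omega>. 0 \<partial>M)"
    \<comment> \<open>The factor 5 is 1 for the limit plus 2 * 2 for the approximants, each at most twice as long.\<close>
    proof (rule nn_integral_dominated_convergence[where w = "\<lambda>\<omega>. ennreal (5 * (norm (U \<omega>) * norm (V \<omega>)))"])
      show "(\<lambda>\<omega>. ennreal (norm (tensor_op (U \<omega>) (V \<omega>) - tensor_op (u i \<omega>) (v i \<omega>)))) \<in> borel_measurable M" for i
        using borel_measurable_norm_diff_simple[OF f sf] by simp
      show "AE \<omega> in M. ennreal (norm (tensor_op (U \<omega>) (V \<omega>) - tensor_op (u i \<omega>) (v i \<omega>))) \<le>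
          ennreal (5 * (norm (U \<omega>) * norm (V \<omega>)))" for i
      proof (rule AE_I2, rule ennreal_leI)
        fix \<omega> assume "\<omega> \<in> space M"
        from bound[OF this, of i] show "norm (tensor_op (U \<omega>) (V \<omega>) - tensor_op (u i \<omega>) (v i \<omega>)) \<le>
          5 * (norm (U \<omega>) * norm (V \<omega>))"
          using norm_triangle_ineq4[of "tensor_op (U \<omega>) (V \<omega>)" "tensor_op (u i \<omega>) (v i \<omega>)"]
            norm_tensor_op_le[of "U \<omega>" "V \<omega>"] by linarith
      qed
      show "AE \<omega> in M. (\<lambda>i. ennreal (norm (tensor_op (U \<omega>) (V \<omega>) - tensor_op (u i \<omega>) (v i \<omega>)))) \<longlonglongrightarrow> 0"
      proof (rule AE_I2)
        fix \<omega> assume "\<omega> \<in> space M"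
        then have "(\<lambda>i. norm (tensor_op (U \<omega>) (V \<omega>) - tensor_op (u i \<omega>) (v i \<omega>))) \<longlonglongrightarrow>
            norm (tensor_op (U \<omega>) (V \<omega>) - tensor_op (U \<omega>) (V \<omega>))"
          by (intro tendsto_intros tensor.tendsto u v)
        then show "(\<lambda>i. ennreal (norm (tensor_op (U \<omega>) (V \<omega>) - tensor_op (u i \<omega>) (v i \<omega>)))) \<longlonglongrightarrow> 0"
          using tendsto_ennrealI by fastforce
      qed
    qed (use fin'[of 5] in auto)
    then show "(\<lambda>i. \<integral>\<^sup>+\<omega>. ennreal (norm (tensor_op (U \<omega>) (V \<omega>) - tensor_op (u i \<omega>) (v i \<omega>))) \<partial>M) \<longlonglongrightarrow> 0"
      by simp
  qed
qed

lemma nn_integral_mult_finite_if_square: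
  fixes f g :: "'a \<Rightarrow> real"
  assumes [measurable]: "f \<in> borel_measurable M" "g \<in> borel_measurable M"
    and "(\<integral>\<^sup>+x. ennreal ((f x)\<^sup>2) \<partial>M) < \<infinity>" "(\<integral>\<^sup>+x. ennreal ((g x)\<^sup>2) \<partial>M) < \<infinity>"
  shows "(\<integral>\<^sup>+x. ennreal (\<bar>f x\<bar> * \<bar>g x\<bar>) \<partial>M) < \<infinity>"
proof -
  have "(\<integral>\<^sup>+x. ennreal (\<bar>f x\<bar> * \<bar>g x\<bar>) \<partial>M) \<le> (\<integral>\<^sup>+x. ennreal ((f x)\<^sup>2) + ennreal ((g x)\<^sup>2) \<partial>M)"
  proof (intro nn_integral_mono)
    fix x
    have "\<bar>f x\<bar> * \<bar>g x\<bar> \<le> (f x)\<^sup>2 + (g x)\<^sup>2"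
      using sum_squares_bound[of "\<bar>f x\<bar>" "\<bar>g x\<bar>", unfolded power2_abs]
        mult_nonneg_nonneg[OF abs_ge_zero abs_ge_zero, of "f x" "g x"] by linarith
    then show "ennreal (\<bar>f x\<bar> * \<bar>g x\<bar>) \<le> ennreal ((f x)\<^sup>2) + ennreal ((g x)\<^sup>2)"
      by (simp flip: ennreal_plus)
  qed
  also have "\<dots> < \<infinity>"
    using assms by (simp add: nn_integral_add)
  finally show ?thesis .
qed

text \<open>
  The only property of covariance operators that matters later: their matrix coefficients are
  expectations of products of real functions.
\<close>
lemma uncentred_cov_inner:
  fixes U :: "'w \<Rightarrow> 'g::{real_inner, banach, second_countable_topology}"
    and V :: "'w \<Rightarrow> 'h::{real_inner, banach, second_countable_topology}"
  assumes U[measurable]: "U \<in> borel_measurable M" and V[measurable]: "V \<in> borel_measurable M"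
    and "(\<integral>\<^sup>+\<omega>. ennreal ((norm (U \<omega>))\<^sup>2) \<partial>M) < \<infinity>" "(\<integral>\<^sup>+\<omega>. ennreal ((norm (V \<omega>))\<^sup>2) \<partial>M) < \<infinity>"
  shows "uncentred_cov M U V h \<bullet> g = (\<integral>\<omega>. (U \<omega> \<bullet> g) * (V \<omega> \<bullet> h) \<partial>M)"
proof -
  have "(\<integral>\<^sup>+\<omega>. ennreal (norm (U \<omega>) * norm (V \<omega>)) \<partial>M) < \<infinity>"
    using nn_integral_mult_finite_if_square[of "\<lambda>\<omega>. norm (U \<omega>)" M "\<lambda>\<omega>. norm (V \<omega>)"] assms by simp
  then obtain C where C: "has_operator_integral M (\<lambda>\<omega>. tensor_op (U \<omega>) (V \<omega>)) C"
    using has_operator_integral_tensor_exists[OF U V] by blast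
  have "uncentred_cov M U V = C"
    unfolding uncentred_cov_def
  proof (rule the_equality[where P = "has_operator_integral M _", OF C])
    fix C' assume "has_operator_integral M (\<lambda>\<omega>. tensor_op (U \<omega>) (V \<omega>)) C'"
    from has_operator_integral_apply[OF this] has_operator_integral_apply[OF C]
    show "C' = C"
      by (intro blinfun_eqI) (rule has_bochner_integral_eq)
  qed
  moreover have "has_bochner_integral M (\<lambda>\<omega>. ((V \<omega> \<bullet> h) *\<^sub>R U \<omega>) \<bullet> g) (C h \<bullet> g)"
    using has_operator_integral_apply[OF C, of h]
    by (intro has_bochner_integral_inner_left) (simp add: tensor_op.rep_eq)
  ultimately show ?thesis
    by (simp add: has_bochner_integral_iff mult.commute)
qed

section \<open>Disintegration along a Markov kernel\<close>

context
  fixes MX :: "'x measure" and MY :: "'y measure" and \<kappa> :: "'x \<Rightarrow> 'y measure"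
  assumes kernel: "\<kappa> \<in> MX \<rightarrow>\<^sub>M prob_algebra MY"
begin

lemma kernel_measurable: "\<kappa> \<in> MX \<rightarrow>\<^sub>M subprob_algebra MY"
  by (rule measurable_prob_algebraD[OF kernel])

lemma kernel_prob_space: "x \<in> space MX \<Longrightarrow> prob_space (\<kappa> x)"
  and kernel_sets: "x \<in> space MX \<Longrightarrow> sets (\<kappa> x) = sets MY"
  using measurable_space[OF kernel, of x] by (simp_all add: space_prob_algebra)

lemma kernel_borel_measurable:
  "x \<in> space MX \<Longrightarrow> u \<in> borel_measurable MY \<Longrightarrow> u \<in> borel_measurable (\<kappa> x)"
  by (subst measurable_cong_sets[OF kernel_sets refl])

lemma measurable_Pair_kernel:
  "x \<in> space MX \<Longrightarrow> Pair x \<in> \<kappa> x \<rightarrow>\<^sub>M MX \<Otimes>\<^sub>M MY"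
  by (subst measurable_cong_sets[OF kernel_sets refl]) (auto intro: measurable_Pair1')

lemma measurable_kernel_pairs:
  "(\<lambda>x. distr (\<kappa> x) (MX \<Otimes>\<^sub>M MY) (Pair x)) \<in> MX \<rightarrow>\<^sub>M subprob_algebra (MX \<Otimes>\<^sub>M MY)"
  by (rule measurable_distr2[OF _ kernel_measurable]) simp

text \<open>
  Pushing \<open>\<kappa> x\<close> forward along \<open>y \<mapsto> (x, y)\<close> makes the integrand independent of \<open>x\<close>, so that only the
  measure varies.
\<close>
lemma kernel_integral_measurable:
  fixes F :: "'x \<Rightarrow> 'y \<Rightarrow> real"
  assumes [measurable]: "case_prod F \<in> borel_measurable (MX \<Otimes>\<^sub>M MY)"
  shows "(\<lambda>x. \<integral>y. F x y \<partial>\<kappa> x) \<in> borel_measurable MX"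
proof -
  have "(\<lambda>x. \<integral>z. case_prod F z \<partial>distr (\<kappa> x) (MX \<Otimes>\<^sub>M MY) (Pair x)) \<in> borel_measurable MX"
    by (rule measurable_compose[OF measurable_kernel_pairs integral_measurable_subprob_algebra[OF assms]])
  then show ?thesis
  proof (rule measurable_cong[THEN iffD1, rotated])
    fix x assume x: "x \<in> space MX"
    have "Pair x \<in> \<kappa> x \<rightarrow>\<^sub>M MX \<Otimes>\<^sub>M MY"
      by (rule measurable_Pair_kernel[OF x])
    from integral_distr[OF this assms]
    show "(\<integral>z. case_prod F z \<partial>distr (\<kappa> x) (MX \<Otimes>\<^sub>M MY) (Pair x)) = (\<integral>y. F x y \<partial>\<kappa> x)"
      by simp
  qed
qed

context
  fixes \<psi> :: "'y \<Rightarrow> 'g::{real_inner, banach, second_countable_topology}"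
  assumes \<psi>[measurable]: "\<psi> \<in> borel_measurable MY"
begin

text \<open>
  Under a probability measure Cauchy-Schwarz against the constant 1 bounds the squared first
  moment by the second moment.
\<close>
lemma integrable_and_jensen_if_finite_second_moment:
  assumes x: "x \<in> finite_cond_second_moment MX \<kappa> \<psi>"
  shows "integrable (\<kappa> x) \<psi>"
    and "ennreal ((norm (\<integral>y. \<psi> y \<partial>\<kappa> x))\<^sup>2) \<le> (\<integral>\<^sup>+y. ennreal ((norm (\<psi> y))\<^sup>2) \<partial>\<kappa> x)"
proof -
  have sp: "x \<in> space MX" and finx: "(\<integral>\<^sup>+y. ennreal ((norm (\<psi> y))\<^sup>2) \<partial>\<kappa> x) < \<infinity>"
    using x by (auto simp: finite_cond_second_moment_def)
  interpret prob_space "\<kappa> x"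
    by (rule kernel_prob_space[OF sp])
  have [measurable]: "\<psi> \<in> borel_measurable (\<kappa> x)"
    using sp \<psi> by (rule kernel_borel_measurable)
  have CS: "(\<integral>\<^sup>+y. ennreal (norm (\<psi> y)) \<partial>\<kappa> x)\<^sup>2 \<le> (\<integral>\<^sup>+y. ennreal ((norm (\<psi> y))\<^sup>2) \<partial>\<kappa> x)"
    using Cauchy_Schwarz_nn_integral[of "\<lambda>y. ennreal (norm (\<psi> y))" "\<kappa> x" "\<lambda>_. 1"]
    by (simp add: ennreal_power emeasure_space_1)
  then have "(\<integral>\<^sup>+y. ennreal (norm (\<psi> y)) \<partial>\<kappa> x)\<^sup>2 < \<infinity>"
    using finx by (rule le_less_trans)
  then have fin1: "(\<integral>\<^sup>+y. ennreal (norm (\<psi> y)) \<partial>\<kappa> x) < \<infinity>"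
    by (auto simp: power2_eq_square ennreal_mult_less_top)
  then show "integrable (\<kappa> x) \<psi>"
    by (intro integrableI_bounded) auto
  then have "ennreal (norm (\<integral>y. \<psi> y \<partial>\<kappa> x)) \<le> (\<integral>\<^sup>+y. ennreal (norm (\<psi> y)) \<partial>\<kappa> x)"
    by (rule integral_norm_bound_ennreal)
  then have "(ennreal (norm (\<integral>y. \<psi> y \<partial>\<kappa> x)))\<^sup>2 \<le> (\<integral>\<^sup>+y. ennreal (norm (\<psi> y)) \<partial>\<kappa> x)\<^sup>2"
    by (rule power_mono) simp
  then show "ennreal ((norm (\<integral>y. \<psi> y \<partial>\<kappa> x))\<^sup>2) \<le> (\<integral>\<^sup>+y. ennreal ((norm (\<psi> y))\<^sup>2) \<partial>\<kappa> x)"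
    using CS by (simp add: ennreal_power)
qed

lemma cond_mean_measurable: "cond_mean MX \<kappa> \<psi> \<psi> \<in> borel_measurable MX"
proof -
  note [measurable] = kernel_measurable
  have [measurable]: "(\<lambda>x. \<integral>\<^sup>+y. ennreal ((norm (\<psi> y))\<^sup>2) \<partial>\<kappa> x) \<in> borel_measurable MX"
    by measurable
  have [measurable]: "finite_cond_second_moment MX \<kappa> \<psi> \<in> sets MX"
    unfolding finite_cond_second_moment_def by measurable
  show ?thesis
    unfolding cond_mean_def by measurable
qed

text \<open>
  Bounded functionals commute with the Bochner integral; so the functions \<open>f\<^sub>g\<close> are the coordinates of
  the single vector-valued function \<open>\<mu>\<close>. Both sides are zero where the second moment is infinite.
\<close>
lemma cond_mean_inner:
  assumes "x \<in> space MX" and u: "\<And>y. y \<in> space MY \<Longrightarrow> u y = \<psi> y \<bullet> g"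
  shows "cond_mean MX \<kappa> \<psi> u x = cond_mean MX \<kappa> \<psi> \<psi> x \<bullet> g"
proof (cases "x \<in> finite_cond_second_moment MX \<kappa> \<psi>")
  case True
  have "(\<integral>y. u y \<partial>\<kappa> x) = (\<integral>y. \<psi> y \<bullet> g \<partial>\<kappa> x)"
    using u sets_eq_imp_space_eq[OF kernel_sets[OF assms(1)]]
    by (intro Bochner_Integration.integral_cong) auto
  also have "\<dots> = (\<integral>y. \<psi> y \<partial>\<kappa> x) \<bullet> g"
    using integrable_and_jensen_if_finite_second_moment(1)[OF True] by (intro integral_inner_left)
  finally show ?thesis
    using True by (simp add: cond_mean_def)
qed (simp add: cond_mean_def)

end

end

context
  fixes M :: "'w measure" and MX :: "'x measure" and MY :: "'y measure"
    and X :: "'w \<Rightarrow> 'x" and Y :: "'w \<Rightarrow> 'y" and \<kappa> :: "'x \<Rightarrow> 'y measure"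
  assumes prob_M: "prob_space M"
    and X[measurable]: "X \<in> M \<rightarrow>\<^sub>M MX" and Y[measurable]: "Y \<in> M \<rightarrow>\<^sub>M MY"
    and rcd: "regular_cond_dist M MX MY X Y \<kappa>"
begin

lemma regular_cond_dist_kernel: "\<kappa> \<in> MX \<rightarrow>\<^sub>M prob_algebra MY"
  using rcd by (simp add: regular_cond_dist_def)

text \<open>
  Both measures agree on measurable rectangles, which form an intersection-stable generator.
\<close>
lemma joint_law_eq_bind:
  "distr M (MX \<Otimes>\<^sub>M MY) (\<lambda>\<omega>. (X \<omega>, Y \<omega>)) =
   distr M MX X \<bind> (\<lambda>x. distr (\<kappa> x) (MX \<Otimes>\<^sub>M MY) (Pair x))"
  (is "?J = ?B")
proof -
  interpret prob_space M
    by (rule prob_M)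
  have ne: "space (distr M MX X) \<noteq> {}"
    using not_empty measurable_space[OF X] by auto
  have K: "(\<lambda>x. distr (\<kappa> x) (MX \<Otimes>\<^sub>M MY) (Pair x)) \<in> distr M MX X \<rightarrow>\<^sub>M subprob_algebra (MX \<Otimes>\<^sub>M MY)"
    using measurable_kernel_pairs[OF regular_cond_dist_kernel] by simp
  let ?E = "{A \<times> B |A B. A \<in> sets MX \<and> B \<in> sets MY}"
  show ?thesis
  proof (rule measure_eqI_generator_eq[where E = ?E and \<Omega> = "space MX \<times> space MY" and A = "\<lambda>_. space MX \<times> space MY"])
    show "Int_stable ?E"
      by (rule Int_stable_pair_measure_generator)
    show "?E \<subseteq> Pow (space MX \<times> space MY)"
      by (auto dest: sets.sets_into_space)
    show "sets ?J = sigma_sets (space MX \<times> space MY) ?E"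
      by (simp add: sets_pair_measure)
    show "sets ?B = sigma_sets (space MX \<times> space MY) ?E"
      using sets_bind_measurable[OF K ne] by (simp add: sets_pair_measure)
    show "range (\<lambda>_. space MX \<times> space MY) \<subseteq> ?E"
      by auto
    show "emeasure ?J (space MX \<times> space MY) \<noteq> \<infinity>" for i :: nat
      by (subst emeasure_distr) (auto simp: emeasure_eq_measure)
    fix R assume "R \<in> ?E"
    then obtain A B where R: "R = A \<times> B" and [measurable]: "A \<in> sets MX" "B \<in> sets MY"
      by blast
    have "emeasure ?J R = emeasure M {\<omega> \<in> space M. X \<omega> \<in> A \<and> Y \<omega> \<in> B}"
      unfolding R by (subst emeasure_distr) (auto intro!: arg_cong[where f = "emeasure M"])
    also have "\<dots> = (\<integral>\<^sup>+x\<in>A. emeasure (\<kappa> x) B \<partial>distr M MX X)"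
      using rcd \<open>A \<in> sets MX\<close> \<open>B \<in> sets MY\<close> by (simp add: regular_cond_dist_def)
    also have "\<dots> = (\<integral>\<^sup>+x. emeasure (distr (\<kappa> x) (MX \<Otimes>\<^sub>M MY) (Pair x)) R \<partial>distr M MX X)"
    proof (rule nn_integral_cong)
      fix x assume "x \<in> space (distr M MX X)"
      then have x: "x \<in> space MX"
        by simp
      have "Pair x \<in> \<kappa> x \<rightarrow>\<^sub>M MX \<Otimes>\<^sub>M MY"
        by (rule measurable_Pair_kernel[OF regular_cond_dist_kernel x])
      then have "emeasure (distr (\<kappa> x) (MX \<Otimes>\<^sub>M MY) (Pair x)) R =
          emeasure (\<kappa> x) (Pair x -` R \<inter> space (\<kappa> x))"
        by (rule emeasure_distr) (simp add: R)
      also have "Pair x -` R \<inter> space (\<kappa> x) = (if x \<in> A then B else {})"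
        using sets.sets_into_space[OF \<open>B \<in> sets MY\<close>] sets_eq_imp_space_eq[OF kernel_sets[OF regular_cond_dist_kernel x]]
        by (auto simp: R)
      finally show "emeasure (\<kappa> x) B * indicator A x = emeasure (distr (\<kappa> x) (MX \<Otimes>\<^sub>M MY) (Pair x)) R"
        by simp
    qed
    also have "\<dots> = emeasure ?B R"
      by (rule emeasure_bind[OF ne K, symmetric]) (simp add: R)
    finally show "emeasure ?J R = emeasure ?B R" .
  qed auto
qed

lemma nn_integral_disintegration:
  assumes [measurable]: "case_prod F \<in> borel_measurable (MX \<Otimes>\<^sub>M MY)"
  shows "(\<integral>\<^sup>+\<omega>. F (X \<omega>) (Y \<omega>) \<partial>M) = (\<integral>\<^sup>+x. \<integral>\<^sup>+y. F x y \<partial>\<kappa> x \<partial>distr M MX X)"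
proof -
  have K: "(\<lambda>x. distr (\<kappa> x) (MX \<Otimes>\<^sub>M MY) (Pair x)) \<in> distr M MX X \<rightarrow>\<^sub>M subprob_algebra (MX \<Otimes>\<^sub>M MY)"
    using measurable_kernel_pairs[OF regular_cond_dist_kernel] by simp
  have "(\<integral>\<^sup>+\<omega>. F (X \<omega>) (Y \<omega>) \<partial>M) = (\<integral>\<^sup>+z. case_prod F z \<partial>distr M (MX \<Otimes>\<^sub>M MY) (\<lambda>\<omega>. (X \<omega>, Y \<omega>)))"
    by (subst nn_integral_distr) auto
  also have "\<dots> = (\<integral>\<^sup>+x. \<integral>\<^sup>+z. case_prod F z \<partial>distr (\<kappa> x) (MX \<Otimes>\<^sub>M MY) (Pair x) \<partial>distr M MX X)"
    unfolding joint_law_eq_bind by (rule nn_integral_bind[OF assms K])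
  also have "\<dots> = (\<integral>\<^sup>+x. \<integral>\<^sup>+y. F x y \<partial>\<kappa> x \<partial>distr M MX X)"
  proof (rule nn_integral_cong)
    fix x assume "x \<in> space (distr M MX X)"
    then have x: "x \<in> space MX"
      by simp
    have "Pair x \<in> \<kappa> x \<rightarrow>\<^sub>M MX \<Otimes>\<^sub>M MY"
      by (rule measurable_Pair_kernel[OF regular_cond_dist_kernel x])
    from nn_integral_distr[OF this, of "case_prod F"] assms
    show "(\<integral>\<^sup>+z. case_prod F z \<partial>distr (\<kappa> x) (MX \<Otimes>\<^sub>M MY) (Pair x)) = (\<integral>\<^sup>+y. F x y \<partial>\<kappa> x)"
      by simp
  qed
  finally show ?thesis .
qed

lemma nn_integral_disintegration_finite:
  assumes [measurable]: "case_prod F \<in> borel_measurable (MX \<Otimes>\<^sub>M MY)"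
    and fin: "(\<integral>\<^sup>+\<omega>. F (X \<omega>) (Y \<omega>) \<partial>M) < \<infinity>"
  shows "AE x in distr M MX X. (\<integral>\<^sup>+y. F x y \<partial>\<kappa> x) < \<infinity>"
proof -
  have "(\<lambda>x. \<integral>\<^sup>+y. F x y \<partial>\<kappa> x) \<in> borel_measurable MX"
    by (rule nn_integral_measurable_subprob_algebra2[OF assms(1) kernel_measurable[OF regular_cond_dist_kernel]])
  then have "AE x in distr M MX X. (\<integral>\<^sup>+y. F x y \<partial>\<kappa> x) \<noteq> \<infinity>"
    using fin unfolding nn_integral_disintegration[OF assms(1)]
    by (intro nn_integral_PInf_AE) auto
  then show ?thesis
    by (simp add: less_top)
qed

text \<open>
  The positive and negative parts are treated separately. Each inner integral is only finite almost
  everywhere, hence the detour through \<open>enn2real\<close>.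
\<close>
lemma integral_disintegration:
  fixes F :: "'x \<Rightarrow> 'y \<Rightarrow> real"
  assumes [measurable]: "case_prod F \<in> borel_measurable (MX \<Otimes>\<^sub>M MY)"
    and int: "integrable M (\<lambda>\<omega>. F (X \<omega>) (Y \<omega>))"
  shows "(\<integral>\<omega>. F (X \<omega>) (Y \<omega>) \<partial>M) = (\<integral>x. (\<integral>y. F x y \<partial>\<kappa> x) \<partial>distr M MX X)"
proof -
  let ?PX = "distr M MX X"
  note [measurable] = kernel_measurable[OF regular_cond_dist_kernel]
  have [measurable]: "F x \<in> borel_measurable (\<kappa> x)" if "x \<in> space MX" for x
    using that by (intro kernel_borel_measurable[OF regular_cond_dist_kernel]) measurable
  have nonneg: "integrable ?PX (\<lambda>x. enn2real (\<integral>\<^sup>+y. ennreal (G x y) \<partial>\<kappa> x)) \<and>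
      (\<integral>x. enn2real (\<integral>\<^sup>+y. ennreal (G x y) \<partial>\<kappa> x) \<partial>?PX) = enn2real (\<integral>\<^sup>+\<omega>. ennreal (G (X \<omega>) (Y \<omega>)) \<partial>M)"
    if [measurable]: "case_prod G \<in> borel_measurable (MX \<Otimes>\<^sub>M MY)"
      and G: "(\<integral>\<^sup>+\<omega>. ennreal (G (X \<omega>) (Y \<omega>)) \<partial>M) < \<infinity>" for G :: "'x \<Rightarrow> 'y \<Rightarrow> real"
  proof -
    have [measurable]: "(\<lambda>(x, y). ennreal (G x y)) \<in> borel_measurable (MX \<Otimes>\<^sub>M MY)"
      by measurable
    have [measurable]: "(\<lambda>x. \<integral>\<^sup>+y. ennreal (G x y) \<partial>\<kappa> x) \<in> borel_measurable MX"
      by (rule nn_integral_measurable_subprob_algebra2) measurable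
    have "AE x in ?PX. ennreal (enn2real (\<integral>\<^sup>+y. ennreal (G x y) \<partial>\<kappa> x)) = (\<integral>\<^sup>+y. ennreal (G x y) \<partial>\<kappa> x)"
    proof -
      have "AE x in ?PX. (\<integral>\<^sup>+y. ennreal (G x y) \<partial>\<kappa> x) < \<infinity>"
        using G by (intro nn_integral_disintegration_finite) measurable
      then show ?thesis
        by eventually_elim simp
    qed
    then have "(\<integral>\<^sup>+x. ennreal (enn2real (\<integral>\<^sup>+y. ennreal (G x y) \<partial>\<kappa> x)) \<partial>?PX) =
        (\<integral>\<^sup>+x. \<integral>\<^sup>+y. ennreal (G x y) \<partial>\<kappa> x \<partial>?PX)"
      by (rule nn_integral_cong_AE)
    also have "\<dots> = (\<integral>\<^sup>+\<omega>. ennreal (G (X \<omega>) (Y \<omega>)) \<partial>M)"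
      by (rule nn_integral_disintegration[symmetric]) measurable
    finally have eq: "(\<integral>\<^sup>+x. ennreal (enn2real (\<integral>\<^sup>+y. ennreal (G x y) \<partial>\<kappa> x)) \<partial>?PX) =
        (\<integral>\<^sup>+\<omega>. ennreal (G (X \<omega>) (Y \<omega>)) \<partial>M)" .
    show ?thesis
      using G unfolding eq[symmetric]
      by (auto intro!: integrableI_nonneg integral_eq_nn_integral)
  qed
  have fin: "(\<integral>\<^sup>+\<omega>. ennreal (F (X \<omega>) (Y \<omega>)) \<partial>M) < \<infinity>" "(\<integral>\<^sup>+\<omega>. ennreal (- F (X \<omega>) (Y \<omega>)) \<partial>M) < \<infinity>"
    using int by (auto simp: real_integrable_def less_top)
  have meas: "case_prod (\<lambda>x y. - F x y) \<in> borel_measurable (MX \<Otimes>\<^sub>M MY)"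
    by measurable
  note pos = nonneg[OF assms(1) fin(1)] and neg = nonneg[of "\<lambda>x y. - F x y", OF meas fin(2)]
  have "AE x in ?PX. (\<integral>\<^sup>+y. ennreal (F x y) \<partial>\<kappa> x) < \<infinity>"
    "AE x in ?PX. (\<integral>\<^sup>+y. ennreal (- F x y) \<partial>\<kappa> x) < \<infinity>"
    using fin by (intro nn_integral_disintegration_finite; measurable)+
  then have "AE x in ?PX. (\<integral>y. F x y \<partial>\<kappa> x) =
      enn2real (\<integral>\<^sup>+y. ennreal (F x y) \<partial>\<kappa> x) - enn2real (\<integral>\<^sup>+y. ennreal (- F x y) \<partial>\<kappa> x)"
    using AE_space
  proof eventually_elim
    case (elim x)
    then show ?case
      by (intro real_lebesgue_integral_def) (auto simp: real_integrable_def)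
  qed
  moreover have "(\<lambda>x. \<integral>y. F x y \<partial>\<kappa> x) \<in> borel_measurable MX"
    by (rule kernel_integral_measurable[OF regular_cond_dist_kernel assms(1)])
  ultimately have "(\<integral>x. (\<integral>y. F x y \<partial>\<kappa> x) \<partial>?PX) =
      (\<integral>x. enn2real (\<integral>\<^sup>+y. ennreal (F x y) \<partial>\<kappa> x) - enn2real (\<integral>\<^sup>+y. ennreal (- F x y) \<partial>\<kappa> x) \<partial>?PX)"
    using pos neg by (intro integral_cong_AE) auto
  also have "\<dots> = enn2real (\<integral>\<^sup>+\<omega>. ennreal (F (X \<omega>) (Y \<omega>)) \<partial>M) -
      enn2real (\<integral>\<^sup>+\<omega>. ennreal (- F (X \<omega>) (Y \<omega>)) \<partial>M)"
    using pos neg by (subst Bochner_Integration.integral_diff) auto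
  also have "\<dots> = (\<integral>\<omega>. F (X \<omega>) (Y \<omega>) \<partial>M)"
    using int by (rule real_lebesgue_integral_def[symmetric])
  finally show ?thesis ..
qed

context
  fixes \<psi> :: "'y \<Rightarrow> 'g::{real_inner, banach, second_countable_topology}"
  assumes \<psi>[measurable]: "\<psi> \<in> borel_measurable MY"
    and fin: "(\<integral>\<^sup>+\<omega>. ennreal ((norm (\<psi> (Y \<omega>)))\<^sup>2) \<partial>M) < \<infinity>"
begin

lemma AE_finite_cond_second_moment:
  "AE x in distr M MX X. x \<in> finite_cond_second_moment MX \<kappa> \<psi>"
proof -
  have "AE x in distr M MX X. (\<integral>\<^sup>+y. ennreal ((norm (\<psi> y))\<^sup>2) \<partial>\<kappa> x) < \<infinity>"
    using fin by (intro nn_integral_disintegration_finite) auto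
  then show ?thesis
    using AE_space by eventually_elim (simp add: finite_cond_second_moment_def)
qed

lemma cond_mean_square_integrable:
  "(\<integral>\<^sup>+x. ennreal ((norm (cond_mean MX \<kappa> \<psi> \<psi> x))\<^sup>2) \<partial>distr M MX X) < \<infinity>"
proof -
  have "(\<integral>\<^sup>+x. ennreal ((norm (cond_mean MX \<kappa> \<psi> \<psi> x))\<^sup>2) \<partial>distr M MX X) \<le>
      (\<integral>\<^sup>+x. \<integral>\<^sup>+y. ennreal ((norm (\<psi> y))\<^sup>2) \<partial>\<kappa> x \<partial>distr M MX X)"
    by (intro nn_integral_mono) (simp add: cond_mean_def integrable_and_jensen_if_finite_second_moment(2)[OF regular_cond_dist_kernel \<psi>])
  also have "\<dots> = (\<integral>\<^sup>+\<omega>. ennreal ((norm (\<psi> (Y \<omega>)))\<^sup>2) \<partial>M)"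
    by (rule nn_integral_disintegration[symmetric]) measurable
  also note fin
  finally show ?thesis .
qed

text \<open>
  The tower property: \<open>E[v(X) \<langle>\<psi>(Y), g\<rangle>] = E[v(X) \<langle>\<mu>(X), g\<rangle>]\<close>. The product is integrable because both
  factors are square integrable, and the convention \<open>\<mu> x = 0\<close> for infinite second moment affects only a
  null set.
\<close>
lemma expectation_mult_cond_mean:
  fixes v :: "'x \<Rightarrow> real"
  assumes [measurable]: "v \<in> borel_measurable MX"
    and v: "(\<integral>\<^sup>+\<omega>. ennreal ((v (X \<omega>))\<^sup>2) \<partial>M) < \<infinity>"
  shows "(\<integral>\<omega>. v (X \<omega>) * (\<psi> (Y \<omega>) \<bullet> g) \<partial>M) =
    (\<integral>x. v x * (cond_mean MX \<kappa> \<psi> \<psi> x \<bullet> g) \<partial>distr M MX X)"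
proof -
  note [measurable] = cond_mean_measurable[OF regular_cond_dist_kernel \<psi>]
  have sq: "(\<integral>\<^sup>+\<omega>. ennreal ((norm (\<psi> (Y \<omega>)) * norm g)\<^sup>2) \<partial>M) < \<infinity>"
    using fin by (simp add: power_mult_distrib ennreal_mult nn_integral_multc ennreal_mult_less_top)
  have "(\<integral>\<^sup>+\<omega>. ennreal (norm (v (X \<omega>) * (\<psi> (Y \<omega>) \<bullet> g))) \<partial>M) \<le>
      (\<integral>\<^sup>+\<omega>. ennreal (\<bar>v (X \<omega>)\<bar> * \<bar>norm (\<psi> (Y \<omega>)) * norm g\<bar>) \<partial>M)"
    by (intro nn_integral_mono ennreal_leI)
      (simp add: abs_mult mult_left_mono Cauchy_Schwarz_ineq2)
  also have "\<dots> < \<infinity>"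
    by (rule nn_integral_mult_finite_if_square[OF _ _ v sq]) measurable
  finally have int: "integrable M (\<lambda>\<omega>. v (X \<omega>) * (\<psi> (Y \<omega>) \<bullet> g))"
    by (intro integrableI_bounded) auto
  have "(\<integral>\<omega>. v (X \<omega>) * (\<psi> (Y \<omega>) \<bullet> g) \<partial>M) = (\<integral>x. (\<integral>y. v x * (\<psi> y \<bullet> g) \<partial>\<kappa> x) \<partial>distr M MX X)"
    using int by (intro integral_disintegration) measurable
  also have "\<dots> = (\<integral>x. v x * (cond_mean MX \<kappa> \<psi> \<psi> x \<bullet> g) \<partial>distr M MX X)"
  proof (rule integral_cong_AE)
    show "AE x in distr M MX X. (\<integral>y. v x * (\<psi> y \<bullet> g) \<partial>\<kappa> x) = v x * (cond_mean MX \<kappa> \<psi> \<psi> x \<bullet> g)"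
      using AE_finite_cond_second_moment
      by eventually_elim (simp add: cond_mean_def integrable_and_jensen_if_finite_second_moment(1)[OF regular_cond_dist_kernel \<psi>])
    have "(\<lambda>x. \<integral>y. v x * (\<psi> y \<bullet> g) \<partial>\<kappa> x) \<in> borel_measurable MX"
      by (rule kernel_integral_measurable[OF regular_cond_dist_kernel]) measurable
    then show "(\<lambda>x. \<integral>y. v x * (\<psi> y \<bullet> g) \<partial>\<kappa> x) \<in> borel_measurable (distr M MX X)"
      by simp
  qed measurable
  finally show ?thesis .
qed

end

end

section \<open>Feature maps and square-integrable functions\<close>

lemma rkhs_eq_0I:
  assumes "is_rkhs S k val \<phi>" and "\<And>x. x \<in> S \<Longrightarrow> h \<bullet> \<phi> x = 0"
  shows "h = 0"
proof -
  have "val h x = val 0 x" if "x \<in> S" for x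
  proof -
    have "val h x = h \<bullet> \<phi> x" "val 0 x = 0 \<bullet> \<phi> x"
      using assms(1) that unfolding is_rkhs_def by blast+
    then show ?thesis
      using assms(2)[OF that] by simp
  qed
  then show ?thesis
    using assms(1) unfolding is_rkhs_def by blast
qed

text \<open>
  The vectors \<open>h\<close> for which the claim holds form a closed subspace. It contains every feature \<open>\<phi> x\<close>,
  since \<open>k x\<close> is measurable, and only the zero vector is orthogonal to all features.
\<close>
lemma rkhs_feature_inner_measurable:
  fixes \<phi> :: "'x \<Rightarrow> 'h::{real_inner, banach}"
  assumes rkhs: "is_rkhs (space MX) k val \<phi>"
    and k: "\<And>x. x \<in> space MX \<Longrightarrow> k x \<in> borel_measurable MX"
  shows "(\<lambda>x. \<phi> x \<bullet> h) \<in> borel_measurable MX"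
proof -
  define V where "V = {h. (\<lambda>x. \<phi> x \<bullet> h) \<in> borel_measurable MX}"
  have "subspace V"
    unfolding V_def by (auto intro!: subspaceI simp: inner_add_right)
  moreover have "closed V"
    unfolding closed_sequential_limits
  proof (intro allI impI)
    fix a l assume a: "(\<forall>n. a n \<in> V) \<and> a \<longlonglongrightarrow> l"
    then have "(\<lambda>n. \<phi> x \<bullet> a n) \<longlonglongrightarrow> \<phi> x \<bullet> l" for x
      by (intro tendsto_intros) auto
    then have "(\<lambda>x. \<phi> x \<bullet> l) \<in> borel_measurable MX"
      by (rule borel_measurable_LIMSEQ_real) (use a in \<open>simp add: V_def\<close>)
    then show "l \<in> V"
      by (simp add: V_def)
  qed
  moreover have "closure V = UNIV"
  proof (rule dense_subspaceI[OF \<open>subspace V\<close>])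
    fix z assume z: "\<And>v. v \<in> V \<Longrightarrow> z \<bullet> v = 0"
    have "\<phi> x \<in> V" if x: "x \<in> space MX" for x
    proof -
      have "\<phi> x' \<bullet> \<phi> x = k x x'" if "x' \<in> space MX" for x'
      proof -
        have "val (\<phi> x) x' = k x x'" "val (\<phi> x) x' = \<phi> x \<bullet> \<phi> x'"
          using rkhs x that unfolding is_rkhs_def by blast+
        then show ?thesis
          by (simp add: inner_commute)
      qed
      then have "(\<lambda>x'. \<phi> x' \<bullet> \<phi> x) \<in> borel_measurable MX \<longleftrightarrow> k x \<in> borel_measurable MX"
        by (intro measurable_cong)
      then show ?thesis
        using k[OF x] by (simp add: V_def)
    qed
    then show "z = 0"
      using z by (intro rkhs_eq_0I[OF rkhs]) auto
  qed
  ultimately show ?thesis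
    by (auto simp: V_def)
qed

lemma integrable_mult_inner:
  fixes U :: "'a \<Rightarrow> 'g::{real_inner, second_countable_topology}"
    and V :: "'a \<Rightarrow> 'h::{real_inner, second_countable_topology}"
  assumes [measurable]: "U \<in> borel_measurable M" "V \<in> borel_measurable M"
    and "(\<integral>\<^sup>+x. ennreal ((norm (U x))\<^sup>2) \<partial>M) < \<infinity>" "(\<integral>\<^sup>+x. ennreal ((norm (V x))\<^sup>2) \<partial>M) < \<infinity>"
  shows "integrable M (\<lambda>x. (U x \<bullet> g) * (V x \<bullet> h))"
proof (rule integrableI_bounded)
  have "(\<integral>\<^sup>+x. ennreal (norm ((U x \<bullet> g) * (V x \<bullet> h))) \<partial>M) \<le>
      (\<integral>\<^sup>+x. ennreal (\<bar>norm (U x)\<bar> * \<bar>norm (V x)\<bar>) * ennreal (norm g * norm h) \<partial>M)"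
  proof (intro nn_integral_mono)
    fix x
    have "\<bar>U x \<bullet> g\<bar> * \<bar>V x \<bullet> h\<bar> \<le> (norm (U x) * norm g) * (norm (V x) * norm h)"
      by (intro mult_mono Cauchy_Schwarz_ineq2) auto
    then show "ennreal (norm ((U x \<bullet> g) * (V x \<bullet> h))) \<le>
        ennreal (\<bar>norm (U x)\<bar> * \<bar>norm (V x)\<bar>) * ennreal (norm g * norm h)"
      by (simp add: abs_mult ac_simps flip: ennreal_mult)
  qed
  also have "\<dots> < \<infinity>"
    using nn_integral_mult_finite_if_square[of "\<lambda>x. norm (U x)" M "\<lambda>x. norm (V x)"] assms
    by (simp add: nn_integral_multc ennreal_mult_less_top)
  finally show "(\<integral>\<^sup>+x. ennreal (norm ((U x \<bullet> g) * (V x \<bullet> h))) \<partial>M) < \<infinity>" .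
qed measurable

text \<open>
  By Pythagoras, subtracting an element of \<open>H\<close> from \<open>d\<close> can only increase the norm, while density makes
  the difference arbitrarily small.
\<close>
lemma AE_zero_if_orthogonal_to_dense:
  assumes dense: "dense_in_l2 Q H" and d: "d \<in> sq_integrable Q"
    and ortho: "\<And>h. h \<in> H \<Longrightarrow> l2_inner Q d h = 0"
  shows "AE x in Q. d x = 0"
proof -
  have meas[measurable]: "u \<in> borel_measurable Q" and int_sq: "integrable Q (\<lambda>x. u x * u x)"
    if "u \<in> sq_integrable Q" for u
    using that by (simp_all add: sq_integrable_def power2_eq_square)
  have int: "integrable Q (\<lambda>x. u x * v x)" if u: "u \<in> sq_integrable Q" and v: "v \<in> sq_integrable Q" for u v
  proof (rule Bochner_Integration.integrable_bound)
    show "integrable Q (\<lambda>x. u x * u x + v x * v x)"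
      by (intro Bochner_Integration.integrable_add int_sq u v)
    show "(\<lambda>x. u x * v x) \<in> borel_measurable Q"
      using meas[OF u] meas[OF v] by measurable
    have "norm (u x * v x) \<le> norm (u x * u x + v x * v x)" for x
      using sum_squares_bound[of "\<bar>u x\<bar>" "\<bar>v x\<bar>", unfolded power2_abs power2_eq_square]
        mult_nonneg_nonneg[OF abs_ge_zero abs_ge_zero, of "u x" "v x"]
      unfolding real_norm_def abs_mult by linarith
    then show "AE x in Q. norm (u x * v x) \<le> norm (u x * u x + v x * v x)"
      by simp
  qed
  have H: "H \<subseteq> sq_integrable Q"
    using dense by (simp add: dense_in_l2_def)
  have less: "l2_inner Q d d < e\<^sup>2" if "0 < e" for e
  proof -
    obtain h where h: "h \<in> H" "l2_norm Q (\<lambda>x. d x - h x) < e"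
      using dense d \<open>0 < e\<close> unfolding dense_in_l2_def by blast
    then have h_sq: "h \<in> sq_integrable Q"
      using H by blast
    have "l2_inner Q (\<lambda>x. d x - h x) (\<lambda>x. d x - h x) =
        (\<integral>x. d x * d x - 2 * (d x * h x) + h x * h x \<partial>Q)"
      unfolding l2_inner_def
      by (rule Bochner_Integration.integral_cong) (simp_all add: algebra_simps)
    also have "\<dots> = l2_inner Q d d - 2 * l2_inner Q d h + l2_inner Q h h"
      unfolding l2_inner_def using int[OF d d] int[OF d h_sq] int[OF h_sq h_sq] by simp
    finally have "l2_inner Q d d \<le> l2_inner Q (\<lambda>x. d x - h x) (\<lambda>x. d x - h x)"
      using ortho[OF h(1)] by (simp add: l2_inner_def)
    also have "\<dots> < e\<^sup>2"
      using h(2) \<open>0 < e\<close> real_sqrt_less_iff[of "l2_inner Q (\<lambda>x. d x - h x) (\<lambda>x. d x - h x)" "e\<^sup>2"]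
      by (simp add: l2_norm_def)
    finally show ?thesis .
  qed
  have "l2_inner Q d d \<le> 0"
  proof (rule ccontr)
    assume "\<not> l2_inner Q d d \<le> 0"
    then show False
      using less[of "sqrt (l2_inner Q d d)"] by simp
  qed
  then have "(\<integral>x. d x * d x \<partial>Q) = 0"
    by (intro antisym) (auto simp: l2_inner_def)
  then show ?thesis
    by (subst (asm) integral_nonneg_eq_0_iff_AE[OF int[OF d d]]) auto
qed

section \<open>The conditional mean embedding formula\<close>

theorem theorem5p3:
  fixes M :: "'w measure" and MX :: "'x measure" and MY :: "'y measure"
    and k :: "'x \<Rightarrow> 'x \<Rightarrow> real" and l :: "'y \<Rightarrow> 'y \<Rightarrow> real"
    and valH :: "'h::{real_inner, banach, second_countable_topology} \<Rightarrow> 'x \<Rightarrow> real"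
    and valG :: "'g::{real_inner, banach, second_countable_topology} \<Rightarrow> 'y \<Rightarrow> real"
    and \<phi> :: "'x \<Rightarrow> 'h" and \<psi> :: "'y \<Rightarrow> 'g"
    and X :: "'w \<Rightarrow> 'x" and Y :: "'w \<Rightarrow> 'y"
    and \<kappa> :: "'x \<Rightarrow> 'y measure"
  defines "PX \<equiv> distr M MX X"
    and "\<mu> \<equiv> cond_mean MX \<kappa> \<psi> \<psi>"
    and "f \<equiv> (\<lambda>g. cond_mean MX \<kappa> \<psi> (valG g))"
    and "CX \<equiv> uncentred_cov M (\<lambda>\<omega>. \<phi> (X \<omega>)) (\<lambda>\<omega>. \<phi> (X \<omega>))"
    and "CXY \<equiv> uncentred_cov M (\<lambda>\<omega>. \<phi> (X \<omega>)) (\<lambda>\<omega>. \<psi> (Y \<omega>))"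
  defines "T \<equiv> (\<lambda>g. pinv CX (blinfun_apply CXY g))"
  assumes "prob_space M"
    and "X \<in> M \<rightarrow>\<^sub>M MX" and "Y \<in> M \<rightarrow>\<^sub>M MY"
    and "borel_space MY"
    and "sym_pos_def_kernel (space MX) k" and "sym_pos_def_kernel (space MY) l"
    and "\<And>x. x \<in> space MX \<Longrightarrow> k x \<in> borel_measurable MX"
    and "\<And>y. y \<in> space MY \<Longrightarrow> l y \<in> borel_measurable MY"
    and "is_rkhs (space MX) k valH \<phi>" and "is_rkhs (space MY) l valG \<psi>"
    and "regular_cond_dist M MX MY X Y \<kappa>"
    and "(\<integral>\<^sup>+\<omega>. ennreal ((norm (\<phi> (X \<omega>)))\<^sup>2 + (norm (\<psi> (Y \<omega>)))\<^sup>2) \<partial>M) < \<infinity>"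
    and "\<And>h. (AE x in PX. valH h x = 0) \<longleftrightarrow> h = 0"
    and "\<And>g. \<exists>hg. \<forall>h. l2_inner PX (\<lambda>x. valH hg x - f g x) (valH h) = 0"
  shows "range (blinfun_apply CXY) \<subseteq> pinv_dom CX \<and> bounded_linear T \<and>
    (\<forall>y\<in>space MY. \<forall>h.
       l2_inner PX (valH h) (\<lambda>x. valG (\<mu> x) y) =
       l2_inner PX (valH h) (\<lambda>x. valG (adjoint T (\<phi> x)) y)) \<and>
    (l2_universal MX k valH \<or>
     dense_in_l2 PX (range valH) \<or>
     (\<forall>g. ae_in_rkhs PX valH (f g)) \<or>
     (\<forall>y\<in>space MY. ae_in_rkhs PX valH (f (\<psi> y)))
     \<longrightarrow> (AE x in PX. \<mu> x = adjoint T (\<phi> x)))"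
proof -
  interpret prob_space M
    by fact
  note X = assms(8) and Y = assms(9)
  note rcd = assms(17)
  note \<kappa> = regular_cond_dist_kernel[OF assms(7) X Y rcd]
  have PX_sets: "sets PX = sets MX" and PX_space: "space PX = space MX"
    by (simp_all add: PX_def)
  have PX_prob: "prob_space PX"
    unfolding PX_def by (rule prob_space_distr[OF X])
  note H = assms(15) and G = assms(16)

  have \<phi>_meas: "(\<lambda>x. \<phi> x \<bullet> h) \<in> borel_measurable MX" for h
    by (rule rkhs_feature_inner_measurable[OF H assms(13)])
  have \<psi>_meas: "(\<lambda>y. \<psi> y \<bullet> g) \<in> borel_measurable MY" for g
    by (rule rkhs_feature_inner_measurable[OF G assms(14)])
  have [measurable]: "\<phi> \<in> borel_measurable MX" "\<psi> \<in> borel_measurable MY"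
    using \<phi>_meas \<psi>_meas by (auto intro: borel_measurable_weak)
  note [measurable] = X Y
  have "(\<integral>\<^sup>+\<omega>. ennreal ((norm (\<phi> (X \<omega>)))\<^sup>2) \<partial>M) + (\<integral>\<^sup>+\<omega>. ennreal ((norm (\<psi> (Y \<omega>)))\<^sup>2) \<partial>M) < \<infinity>"
    using assms(18) by (simp add: nn_integral_add)
  then have fin_\<phi>: "(\<integral>\<^sup>+\<omega>. ennreal ((norm (\<phi> (X \<omega>)))\<^sup>2) \<partial>M) < \<infinity>"
    and fin_\<psi>: "(\<integral>\<^sup>+\<omega>. ennreal ((norm (\<psi> (Y \<omega>)))\<^sup>2) \<partial>M) < \<infinity>"
    by simp_all

  have valH: "valH h x = \<phi> x \<bullet> h" if "x \<in> space MX" for h x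
    using H that by (auto simp: is_rkhs_def inner_commute)
  have valG: "valG g y = \<psi> y \<bullet> g" if "y \<in> space MY" for g y
    using G that by (auto simp: is_rkhs_def inner_commute)
  have \<mu>_meas[measurable]: "\<mu> \<in> borel_measurable MX"
    unfolding \<mu>_def by (rule cond_mean_measurable[OF \<kappa>]) measurable
  have fin_\<mu>: "(\<integral>\<^sup>+x. ennreal ((norm (\<mu> x))\<^sup>2) \<partial>PX) < \<infinity>"
    unfolding \<mu>_def PX_def by (rule cond_mean_square_integrable[OF assms(7) X Y rcd _ fin_\<psi>]) measurable
  have f: "f g x = \<mu> x \<bullet> g" if "x \<in> space MX" for g x
    unfolding f_def \<mu>_def
    by (rule cond_mean_inner[OF \<kappa> _ that]) (simp_all add: valG)
  have fin_\<phi>X: "(\<integral>\<^sup>+x. ennreal ((norm (\<phi> x))\<^sup>2) \<partial>PX) < \<infinity>"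
    using fin_\<phi> unfolding PX_def by (subst nn_integral_distr[OF X]) auto

  have int_\<phi>\<phi>: "integrable PX (\<lambda>x. (\<phi> x \<bullet> h) * (\<phi> x \<bullet> h'))" for h h'
    by (rule integrable_mult_inner[OF _ _ fin_\<phi>X fin_\<phi>X]) (simp_all add: PX_def)
  have int_\<mu>\<phi>: "integrable PX (\<lambda>x. (\<mu> x \<bullet> g) * (\<phi> x \<bullet> h))" for g h
    by (rule integrable_mult_inner[OF _ _ fin_\<mu> fin_\<phi>X]) (simp_all add: PX_def)
  have int_\<mu>\<mu>: "integrable PX (\<lambda>x. (\<mu> x \<bullet> g) * (\<mu> x \<bullet> g'))" for g g'
    by (rule integrable_mult_inner[OF _ _ fin_\<mu> fin_\<mu>]) (simp_all add: PX_def)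

  have CX: "CX h \<bullet> h' = (\<integral>x. (\<phi> x \<bullet> h) * (\<phi> x \<bullet> h') \<partial>PX)" for h h'
  proof -
    have "CX h \<bullet> h' = (\<integral>\<omega>. (\<phi> (X \<omega>) \<bullet> h') * (\<phi> (X \<omega>) \<bullet> h) \<partial>M)"
      unfolding CX_def by (rule uncentred_cov_inner[OF _ _ fin_\<phi> fin_\<phi>]) measurable
    also have "\<dots> = (\<integral>x. (\<phi> x \<bullet> h) * (\<phi> x \<bullet> h') \<partial>PX)"
      unfolding PX_def by (subst integral_distr[OF X]) (simp_all add: mult.commute)
    finally show ?thesis .
  qed
  have CXY: "CXY g \<bullet> h = (\<integral>x. (\<mu> x \<bullet> g) * (\<phi> x \<bullet> h) \<partial>PX)" for g h
  proof -
    have "(\<integral>\<^sup>+\<omega>. ennreal ((\<phi> (X \<omega>) \<bullet> h)\<^sup>2) \<partial>M) \<le>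
        (\<integral>\<^sup>+\<omega>. ennreal ((norm (\<phi> (X \<omega>)))\<^sup>2) * ennreal ((norm h)\<^sup>2) \<partial>M)"
    proof (intro nn_integral_mono)
      fix \<omega>
      have "(\<phi> (X \<omega>) \<bullet> h)\<^sup>2 \<le> (norm (\<phi> (X \<omega>)))\<^sup>2 * (norm h)\<^sup>2"
        using power_mono[OF Cauchy_Schwarz_ineq2[of "\<phi> (X \<omega>)" h] abs_ge_zero, of 2]
        by (simp only: power2_abs power_mult_distrib)
      then show "ennreal ((\<phi> (X \<omega>) \<bullet> h)\<^sup>2) \<le> ennreal ((norm (\<phi> (X \<omega>)))\<^sup>2) * ennreal ((norm h)\<^sup>2)"
        by (simp flip: ennreal_mult)
    qed
    also have "\<dots> < \<infinity>"
      using fin_\<phi> by (simp add: nn_integral_multc ennreal_mult_less_top)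
    finally have fin_h: "(\<integral>\<^sup>+\<omega>. ennreal ((\<phi> (X \<omega>) \<bullet> h)\<^sup>2) \<partial>M) < \<infinity>" .
    have "CXY g \<bullet> h = (\<integral>\<omega>. (\<phi> (X \<omega>) \<bullet> h) * (\<psi> (Y \<omega>) \<bullet> g) \<partial>M)"
      unfolding CXY_def by (rule uncentred_cov_inner[OF _ _ fin_\<phi> fin_\<psi>]) measurable
    also have "\<dots> = (\<integral>x. (\<phi> x \<bullet> h) * (\<mu> x \<bullet> g) \<partial>PX)"
      unfolding PX_def \<mu>_def
      by (rule expectation_mult_cond_mean[OF assms(7) X Y rcd _ fin_\<psi> _ fin_h]) measurable
    finally show ?thesis
      by (simp add: mult.commute)
  qed
  have CX_selfadj: "CX h \<bullet> h' = h \<bullet> CX h'" for h h'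
    using CX[of h h'] CX[of h' h] by (simp add: inner_commute mult.commute)

  have ae_zero: "h = 0" if "AE x in PX. \<phi> x \<bullet> h = 0" for h
  proof -
    have "AE x in PX. valH h x = 0"
      using that AE_space[of PX] by eventually_elim (simp add: valH PX_space)
    then show ?thesis
      by (simp only: assms(19))
  qed
  have CX_inj: "h = 0" if "CX h = 0" for h
  proof (rule ae_zero)
    have "(\<integral>x. (\<phi> x \<bullet> h) * (\<phi> x \<bullet> h) \<partial>PX) = 0"
      using CX[of h h] that by simp
    then show "AE x in PX. \<phi> x \<bullet> h = 0"
      by (subst (asm) integral_nonneg_eq_0_iff_AE[OF int_\<phi>\<phi>]) auto
  qed

  \<comment> \<open>\<open>R g\<close> is a choice of \<open>h\<^sub>g\<close>; it turns out to be unique and equal to \<open>T g\<close>.\<close>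
  define R where "R = (\<lambda>g. SOME hg. \<forall>h. l2_inner PX (\<lambda>x. valH hg x - f g x) (valH h) = 0)"
  have R_eq: "(\<integral>x. (\<phi> x \<bullet> R g - \<mu> x \<bullet> g) * (\<phi> x \<bullet> h) \<partial>PX) = 0" for g h
  proof -
    have "l2_inner PX (\<lambda>x. valH (R g) x - f g x) (valH h) = 0"
      using someI_ex[OF assms(20), of g] unfolding R_def by blast
    also have "l2_inner PX (\<lambda>x. valH (R g) x - f g x) (valH h) =
        (\<integral>x. (\<phi> x \<bullet> R g - \<mu> x \<bullet> g) * (\<phi> x \<bullet> h) \<partial>PX)"
      unfolding l2_inner_def
      by (rule Bochner_Integration.integral_cong) (simp_all add: PX_space valH f)
    finally show ?thesis .
  qed
  have CX_R: "CX (R g) = CXY g" for g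
  proof -
    have "CX (R g) \<bullet> h - CXY g \<bullet> h = 0" for h
      using R_eq[of g h] int_\<phi>\<phi> int_\<mu>\<phi> unfolding CX CXY
      by (subst Bochner_Integration.integral_diff[symmetric]) (auto simp: left_diff_distrib)
    then have "(CX (R g) - CXY g) \<bullet> (CX (R g) - CXY g) = 0"
      by (simp only: inner_diff_left)
    then show ?thesis
      by simp
  qed
  have T_R: "T = R"
    using pinv_selfadjoint_injective[OF CX_selfadj CX_inj] by (simp add: T_def fun_eq_iff flip: CX_R)
  have T_lin: "bounded_linear T"
    using bounded_linear_factor_through_selfadjoint[OF CX_selfadj CX_inj, of R CXY] CX_R
    by (simp add: T_R)
  have dom: "range (blinfun_apply CXY) \<subseteq> pinv_dom CX"
  proof -
    have "CXY g = CX (R g) + 0" for g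
      by (simp add: CX_R)
    moreover have "0 \<in> (op_range CX)\<^sup>\<bottom>"
      by (simp add: orthogonal_comp_def orthogonal_def)
    ultimately show ?thesis
      unfolding pinv_dom_def op_range_def by blast
  qed
  have adj: "adjoint T z \<bullet> g = z \<bullet> T g" for z g
    using inner_adjoint[OF T_lin, of g z] by (simp add: inner_commute)

  have part1: "l2_inner PX (valH h) (\<lambda>x. valG (\<mu> x) y) =
      l2_inner PX (valH h) (\<lambda>x. valG (adjoint T (\<phi> x)) y)" if y: "y \<in> space MY" for y h
  proof -
    have "l2_inner PX (valH h) (\<lambda>x. valG (\<mu> x) y) = (\<integral>x. (\<mu> x \<bullet> \<psi> y) * (\<phi> x \<bullet> h) \<partial>PX)"
      unfolding l2_inner_def
      by (rule Bochner_Integration.integral_cong) (simp_all add: PX_space valH valG[OF y] ac_simps inner_commute)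
    also have "\<dots> = CX (T (\<psi> y)) \<bullet> h"
      by (simp add: CXY CX_R T_R)
    also have "\<dots> = (\<integral>x. (\<phi> x \<bullet> T (\<psi> y)) * (\<phi> x \<bullet> h) \<partial>PX)"
      by (rule CX)
    also have "\<dots> = l2_inner PX (valH h) (\<lambda>x. valG (adjoint T (\<phi> x)) y)"
      unfolding l2_inner_def
      by (rule Bochner_Integration.integral_cong)
        (simp_all add: PX_space valH valG[OF y] inner_commute[of "\<psi> y"] adj)
    finally show ?thesis .
  qed

  \<comment> \<open>An almost everywhere representative \<open>h\<close> of \<open>f\<^sub>g\<close> solves the same equation \<open>CX h = CXY g\<close> as \<open>R g\<close>.\<close>
  have ae_rkhs: "AE x in PX. \<mu> x \<bullet> g = \<phi> x \<bullet> R g" if fg: "ae_in_rkhs PX valH (f g)" for g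
  proof -
    obtain h where "AE x in PX. f g x = valH h x"
      using fg by (auto simp: ae_in_rkhs_def)
    then have h: "AE x in PX. \<mu> x \<bullet> g = \<phi> x \<bullet> h"
      using AE_space[of PX] by eventually_elim (simp add: f valH PX_space)
    have "CX h \<bullet> h' = CXY g \<bullet> h'" for h'
      unfolding CX CXY using h by (intro integral_cong_AE) (auto simp: PX_def)
    then have "CX h = CXY g"
      by (metis vector_eq_rdot)
    then have "CX (h - R g) = 0"
      by (simp add: blinfun.diff_right CX_R)
    then have "h = R g"
      using CX_inj[of "h - R g"] by simp
    then show ?thesis
      using h by simp
  qed
  have ae_dense: "AE x in PX. \<mu> x \<bullet> g = \<phi> x \<bullet> R g" if dense: "dense_in_l2 PX (range valH)" for g
  proof -
    define d where "d = (\<lambda>x. \<phi> x \<bullet> R g - \<mu> x \<bullet> g)"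
    have "integrable PX (\<lambda>x. ((\<phi> x \<bullet> R g) * (\<phi> x \<bullet> R g) - (\<mu> x \<bullet> g) * (\<phi> x \<bullet> R g)) +
        ((\<mu> x \<bullet> g) * (\<mu> x \<bullet> g) - (\<mu> x \<bullet> g) * (\<phi> x \<bullet> R g)))"
      by (intro Bochner_Integration.integrable_add Bochner_Integration.integrable_diff
          int_\<phi>\<phi> int_\<mu>\<phi> int_\<mu>\<mu>)
    also have "(\<lambda>x. ((\<phi> x \<bullet> R g) * (\<phi> x \<bullet> R g) - (\<mu> x \<bullet> g) * (\<phi> x \<bullet> R g)) +
        ((\<mu> x \<bullet> g) * (\<mu> x \<bullet> g) - (\<mu> x \<bullet> g) * (\<phi> x \<bullet> R g))) = (\<lambda>x. (d x)\<^sup>2)"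
      by (simp add: d_def fun_eq_iff power2_eq_square algebra_simps)
    finally have "d \<in> sq_integrable PX"
      by (simp add: sq_integrable_def d_def PX_def)
    moreover have "l2_inner PX d (valH h) = 0" for h
    proof -
      have "l2_inner PX d (valH h) = (\<integral>x. d x * (\<phi> x \<bullet> h) \<partial>PX)"
        unfolding l2_inner_def
        by (rule Bochner_Integration.integral_cong) (simp_all add: PX_space valH)
      then show ?thesis
        using R_eq[of g h] by (simp add: d_def)
    qed
    ultimately have "AE x in PX. d x = 0"
      using AE_zero_if_orthogonal_to_dense[OF dense] by blast
    then show ?thesis
      by eventually_elim (simp add: d_def)
  qed

  have part2: "AE x in PX. \<mu> x = adjoint T (\<phi> x)"
    if C: "l2_universal MX k valH \<or> dense_in_l2 PX (range valH) \<or>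
      (\<forall>g. ae_in_rkhs PX valH (f g)) \<or> (\<forall>y\<in>space MY. ae_in_rkhs PX valH (f (\<psi> y)))"
  proof -
    have "AE x in PX. \<mu> x \<bullet> \<psi> y = \<phi> x \<bullet> R (\<psi> y)" if "y \<in> space MY" for y
      using C that ae_dense[of "\<psi> y"] ae_rkhs[of "\<psi> y"] PX_prob PX_sets
      unfolding l2_universal_def by blast
    then have ae: "AE x in PX. (\<mu> x - adjoint T (\<phi> x)) \<bullet> \<psi> y = 0" if "y \<in> space MY" for y
      using that by (simp add: inner_diff_left adj flip: T_R)
    \<comment> \<open>A countable set of features lets the null sets be united, and continuity recovers all features.\<close>
    obtain D where D: "countable D" "D \<subseteq> \<psi> ` space MY" "\<psi> ` space MY \<subseteq> closure D"
      using separable[of "\<psi> ` space MY"] by blast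
    have "AE x in PX. \<forall>d\<in>D. (\<mu> x - adjoint T (\<phi> x)) \<bullet> d = 0"
      using D(1,2) ae by (subst AE_ball_countable) auto
    then show ?thesis
    proof eventually_elim
      case (elim x)
      have "closure D \<subseteq> {z. (\<mu> x - adjoint T (\<phi> x)) \<bullet> z = 0}"
        using elim by (intro closure_minimal closed_Collect_eq continuous_intros) auto
      then have "(\<mu> x - adjoint T (\<phi> x)) \<bullet> \<psi> y = 0" if "y \<in> space MY" for y
        using D(3) that by blast
      then have "\<mu> x - adjoint T (\<phi> x) = 0"
        by (rule rkhs_eq_0I[OF G])
      then show ?case
        by simp
    qed
  qed
  show ?thesis
    using dom T_lin part1 part2 by blast
qed

end
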